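(* Let $p\in(0,1)$ and let $(X_n)_{n\in\mathbb{Z}}$ be a stationary, strongly mixing sequence of real-valued random variables with distribution function $F$ and strong mixing coefficients $\alpha(n)$. Let $t_p=F^{-1}(p)$. Assume that for some $\rho>0$ and $M\neq 0$ $$F(t_p+h)-F(t_p)=M|h|^\rho\operatorname{sgn}(h)+o(|h|^\rho)\quad\text{as }h\to 0,$$ and that $\sum_{n=1}^\infty\alpha(n)<\infty$. Consider the circular block bootstrap with block length $l=l_n$ chosen such that $\frac1l+\frac ln\to 0$ as $n\to\infty$. Then $$F_n^{\star-1}(p)-t_p=\left(\frac{|p-F_n^\star(t_p)|}{M}\right)^{1/\rho}\operatorname{sgn}\bigl(p-F_n^\star(t_p)\bigr)+R_n^\star,$$ where $R_n^\star=o_P(n^{-1/(2\rho)})$, i.e. $n^{1/(2\rho)}R_n^\star\to 0$ in probability as $n\to\infty$.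
   Context: For a distribution function $G$ and $p\in(0,1)$, the $p$-quantile is $G^{-1}(p):=\inf\{t\in\mathbb{R}: G(t)\ge p\}$. The strong mixing coefficients are $$\alpha(k):=\sup\{|P(A\cap B)-P(A)P(B)|: A\in\mathcal{F}_1^n,\ B\in\mathcal{F}_{n+k}^\infty,\ n\in\mathbb{Z}\},$$ where $\mathcal{F}_a^l$ is the $\sigma$-field generated by $X_a,\ldots,X_l$ (trivial if $l<a$); the sequence is strongly mixing if $\alpha(k)\to 0$ as $k\to\infty$. Circular block bootstrap: for each $n$, let $l=l_n\in\{1,\ldots,n\}$ be the block length and $b=\lfloor n/l\rfloor$. Extend the sample $X_1,\ldots,X_n$ periodically, i.e. in the resampling an index $i+n$ is read as $i$ ($X_{i+n}:=X_i$). The bootstrap sample $X_1^\star,\ldots,X_{bl}^\star$ consists of $b$ blocks of length $l$ which, conditionally on $(X_n)_{n\in\mathbb{N}}$, are independent, each one chosen uniformly: the starting index $j$ is uniform on $\{1,\ldots,n\}$, so that for $k=0,\ldots,b-1$ and $j=1,\ldots,n$ $$P^\star\bigl(X^\star_{kl+1}=X_j,\ldots,X^\star_{(k+1)l}=X_{j+l-1}\bigr)=\tfrac1n,$$ where $P^\star$ is the conditional probability given $(X_n)_{n\in\mathbb{N}}$. Set $F_n^\star(t):=\frac{1}{bl}\sum_{i=1}^{bl}\mathbf{1}_{\{X_i^\star\le t\}}$ and let $F_n^{\star-1}(p)$ be its $p$-quantile. Convergence in probability of $n^{1/(2\rho)}R_n^\star$ is with respect to the joint law of the data and the resampling. Convention: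 $\operatorname{sgn}(0)=0$. (Since $F$ is nondecreasing, $M\ne 0$ forces $M>0$.) *)

theory Defs
  imports "HOL-Probability.Probability" "HOL-Library.Landau_Symbols"
begin

definition quantile :: "(real \<Rightarrow> real) \<Rightarrow> real \<Rightarrow> real" where
  "quantile G p = Inf {t. G t \<ge> p}"

definition stationary_process :: "'a measure \<Rightarrow> (int \<Rightarrow> 'a \<Rightarrow> real) \<Rightarrow> bool" where
  "stationary_process P X \<longleftrightarrow>
     (\<forall>i. X i \<in> borel_measurable P) \<and>
     (\<forall>k. distr P (\<Pi>\<^sub>M i\<in>UNIV. borel) (\<lambda>\<omega> i. X (i + k) \<omega>)
        = distr P (\<Pi>\<^sub>M i\<in>UNIV. borel) (\<lambda>\<omega> i. X i \<omega>))"

definition gen_sigma :: "'a measure \<Rightarrow> (int \<Rightarrow> 'a \<Rightarrow> real) \<Rightarrow> int set \<Rightarrow> 'a measure" where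
  "gen_sigma P X I = sigma (space P) (\<Union>i\<in>I. {X i -` B \<inter> space P | B. B \<in> sets borel})"

definition mixing_coeff :: "'a measure \<Rightarrow> (int \<Rightarrow> 'a \<Rightarrow> real) \<Rightarrow> nat \<Rightarrow> real" where
  "mixing_coeff P X k =
     Sup {\<bar>measure P (A \<inter> B) - measure P A * measure P B\<bar> | A B n.
            A \<in> sets (gen_sigma P X {1..n}) \<and> B \<in> sets (gen_sigma P X {n + int k..})}"

definition strongly_mixing :: "'a measure \<Rightarrow> (int \<Rightarrow> 'a \<Rightarrow> real) \<Rightarrow> bool" where
  "strongly_mixing P X \<longleftrightarrow> mixing_coeff P X \<longlonglongrightarrow> 0"

text \<open>Conditional probability of the event \<open>A\<close> given \<open>X\<^sub>1, X\<^sub>2, \<dots>\<close>, as a random variable.\<close>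

definition P_star :: "'a measure \<Rightarrow> (int \<Rightarrow> 'a \<Rightarrow> real) \<Rightarrow> 'a set \<Rightarrow> 'a \<Rightarrow> real" where
  "P_star P X A = real_cond_exp P (gen_sigma P X {1..}) (indicator A)"

text \<open>\<open>J n k\<close> is the starting index of block \<open>k\<close> (with \<open>k < \<lfloor>n/l\<rfloor>\<close>) in the resample of
  \<open>X\<^sub>1, \<dots>, X\<^sub>n\<close>. Given the data, these indices are uniform on \<open>{1..n}\<close> and independent. As they
  are finite-valued, conditional independence is stated through their joint point probabilities.
  Nothing is assumed about the joint law for different \<open>n\<close>.\<close>

definition cbb_start_indices ::
  "'a measure \<Rightarrow> (int \<Rightarrow> 'a \<Rightarrow> real) \<Rightarrow> (nat \<Rightarrow> nat) \<Rightarrow> (nat \<Rightarrow> nat \<Rightarrow> 'a \<Rightarrow> nat) \<Rightarrow> bool" where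
  "cbb_start_indices P X l J \<longleftrightarrow>
     (\<forall>n\<ge>1.
        (\<forall>k < n div l n. J n k \<in> measurable P (count_space {1..n})) \<and>
        (\<forall>k < n div l n. \<forall>j\<in>{1..n}.
           AE \<omega> in P. P_star P X {\<omega>' \<in> space P. J n k \<omega>' = j} \<omega> = 1 / real n) \<and>
        (\<forall>j \<in> {..<n div l n} \<rightarrow> {1..n}.
           AE \<omega> in P. P_star P X {\<omega>' \<in> space P. \<forall>k < n div l n. J n k \<omega>' = j k} \<omega>
             = (\<Prod>k < n div l n. P_star P X {\<omega>' \<in> space P. J n k \<omega>' = j k} \<omega>)))"

text \<open>Index \<open>m \<ge> 1\<close> read periodically in \<open>{1..n}\<close>.\<close>

definition wrap_index :: "nat \<Rightarrow> nat \<Rightarrow> nat" where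
  "wrap_index n m = (m - 1) mod n + 1"

text \<open>Position \<open>i = k l + r\<close> with \<open>1 \<le> r \<le> l\<close> lies in block \<open>k\<close>, at offset \<open>r - 1\<close> from its start.\<close>

definition boot_sample ::
  "(int \<Rightarrow> 'a \<Rightarrow> real) \<Rightarrow> (nat \<Rightarrow> nat) \<Rightarrow> (nat \<Rightarrow> nat \<Rightarrow> 'a \<Rightarrow> nat) \<Rightarrow> nat \<Rightarrow> nat \<Rightarrow> 'a \<Rightarrow> real" where
  "boot_sample X l J n i \<omega> =
     X (int (wrap_index n (J n ((i - 1) div l n) \<omega> + (i - 1) mod l n))) \<omega>"

definition boot_ecdf ::
  "(int \<Rightarrow> 'a \<Rightarrow> real) \<Rightarrow> (nat \<Rightarrow> nat) \<Rightarrow> (nat \<Rightarrow> nat \<Rightarrow> 'a \<Rightarrow> nat) \<Rightarrow> nat \<Rightarrow> 'a \<Rightarrow> real \<Rightarrow> real" where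
  "boot_ecdf X l J n \<omega> t =
     (\<Sum>i = 1..n div l n * l n. indicator {..t} (boot_sample X l J n i \<omega>))
       / real (n div l n * l n)"

text \<open>Measurability is required because \<open>measure\<close> is 0 on non-measurable sets.\<close>

definition converges_in_probability ::
  "'a measure \<Rightarrow> (nat \<Rightarrow> 'a \<Rightarrow> real) \<Rightarrow> real \<Rightarrow> bool" where
  "converges_in_probability P Y c \<longleftrightarrow>
     (\<forall>n. Y n \<in> borel_measurable P) \<and>
     (\<forall>\<epsilon>>0. (\<lambda>n. measure P {\<omega> \<in> space P. \<bar>Y n \<omega> - c\<bar> > \<epsilon>}) \<longlonglongrightarrow> 0)"

end

theory Submission
  imports Defs
begin

text \<open>
  The event \<open>F\<^sub>n\<^sup>\<star>\<^sup>-\<^sup>1(p) \<le> t\<^sub>p + h\<close> is \<open>F\<^sub>n\<^sup>\<star>(t\<^sub>p + h) \<ge> p\<close>. With \<open>h = v n powr (- 1 / (2\<rho>))\<close> and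
  \<open>D\<^sub>n = \<surd>n (p - F\<^sub>n\<^sup>\<star>(t\<^sub>p))\<close> it reads \<open>D\<^sub>n \<le> Y\<^sub>n(v)\<close>, where
  \<open>Y\<^sub>n(v) = \<surd>n (F\<^sub>n\<^sup>\<star>(t\<^sub>p + h) - F\<^sub>n\<^sup>\<star>(t\<^sub>p))\<close> should converge in probability to \<open>\<gamma>(v) = M |v|\<^sup>\<rho> sgn v\<close>.
  Since \<open>D\<^sub>n\<close> is tight, Ghosh's comparison argument then shows that the scaled quantile is close to
  \<open>\<gamma>\<^sup>-\<^sup>1(D\<^sub>n)\<close>, which is the claim.

  Both tightness and the limit of \<open>Y\<^sub>n(v)\<close> come from one second moment bound for bootstrap
  frequencies: if \<open>P(X\<^sub>i \<in> B) = q\<close>, the bootstrap frequency of \<open>B\<close> has mean square error at most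
  \<open>3 C(q) / n\<close> with \<open>C(q) = q + 2 \<Sum>\<^sub>k min (\<alpha>(k), q)\<close>. Indeed, the covariance of the indicators of
  \<open>X\<^sub>i \<in> B\<close> and \<open>X\<^sub>j \<in> B\<close> is at most \<open>min (\<alpha>(|i - j|), q)\<close>, so that a sum over any \<open>m\<close> distinct
  indices, in particular over a circular block, has variance at most \<open>m C(q)\<close>. Dominated convergence
  gives \<open>C(q) \<rightarrow> 0\<close> as \<open>q \<rightarrow> 0\<close>, which controls the increments over shrinking intervals.
\<close>

subsection \<open>Quantiles\<close>

text \<open>The limits at both ends make \<open>?S\<close> nonempty and bounded below, so that
  \<open>Inf\<close> is a genuine infimum; right continuity puts the infimum into the set.\<close>

lemma quantile_le_iff:
  fixes G :: "real \<Rightarrow> real"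
  assumes mono: "mono G" and right_cont: "\<And>t. continuous (at_right t) G"
    and bot: "(G \<longlongrightarrow> 0) at_bot" and top: "(G \<longlongrightarrow> 1) at_top"
    and p: "0 < p" "p < 1"
  shows "quantile G p \<le> t \<longleftrightarrow> p \<le> G t"
proof -
  let ?S = "{t. p \<le> G t}"
  obtain N where N: "\<And>s. s \<le> N \<Longrightarrow> G s < p"
    using order_tendstoD(2)[OF bot p(1)] unfolding eventually_at_bot_linorder by blast
  have bdd: "bdd_below ?S"
    using N by (intro bdd_belowI[of _ N]) (metis linorder_not_less mem_Collect_eq nle_le)
  obtain N' where "\<And>s. s \<ge> N' \<Longrightarrow> p < G s"
    using order_tendstoD(1)[OF top p(2)] unfolding eventually_at_top_linorder by blast
  then have nonempty: "?S \<noteq> {}"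
    using less_imp_le by blast
  show ?thesis
  proof
    assume "p \<le> G t"
    then show "quantile G p \<le> t"
      unfolding quantile_def by (intro cInf_lower bdd) simp
  next
    assume le: "quantile G p \<le> t"
    have "p \<le> G u" if "t < u" for u
    proof -
      have "Inf ?S < u"
        using le that unfolding quantile_def by simp
      then obtain s where "p \<le> G s" "s < u"
        using cInf_less_iff[OF nonempty bdd] by blast
      then show ?thesis
        using monoD[OF mono, of s u] by simp
    qed
    then have "\<forall>\<^sub>F u in at_right t. p \<le> G u"
      unfolding eventually_at_right_field by (intro exI[of _ "t + 1"]) simp
    moreover have "(G \<longlongrightarrow> G t) (at_right t)"
      using right_cont unfolding continuous_within .
    ultimately show "p \<le> G t"
      by (intro tendsto_lowerbound) auto
  qed
qed

text \<open>Left of the quantile the values are below \<open>p\<close>, and the left limit passes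
  this bound on; the opposite inequality is \<open>quantile_le_iff\<close> at the quantile
  itself.\<close>

lemma cdf_at_quantile:
  fixes F :: "real \<Rightarrow> real"
  assumes F: "mono F" "\<And>t. continuous (at_right t) F" "(F \<longlongrightarrow> 0) at_bot" "(F \<longlongrightarrow> 1) at_top"
    and p: "0 < p" "p < 1"
    and cont: "((\<lambda>h. F (quantile F p + h)) \<longlongrightarrow> F (quantile F p)) (at 0)"
  shows "F (quantile F p) = p"
proof (rule antisym)
  have "F (quantile F p + h) \<le> p" if "h < 0" for h
    using quantile_le_iff[OF F p, of "quantile F p + h"] that by linarith
  then have "\<forall>\<^sub>F h in at_left 0. F (quantile F p + h) \<le> p"
    unfolding eventually_at_left_field by (intro exI[of _ "-1"]) simp
  moreover have "((\<lambda>h. F (quantile F p + h)) \<longlongrightarrow> F (quantile F p)) (at_left 0)"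
    by (rule tendsto_within_subset[OF cont]) simp
  ultimately show "F (quantile F p) \<le> p"
    by (intro tendsto_upperbound) auto
  show "p \<le> F (quantile F p)"
    using quantile_le_iff[OF F p] by blast
qed

subsection \<open>Covariances under strong mixing\<close>

lemma measurable_gen_sigma:
  assumes "i \<in> I"
  shows "X i \<in> borel_measurable (gen_sigma P X I)"
proof (rule measurableI)
  fix B :: "real set" assume "B \<in> sets borel"
  then show "X i -` B \<inter> space (gen_sigma P X I) \<in> sets (gen_sigma P X I)"
    unfolding gen_sigma_def using assms
    by (subst sets_measure_of) (auto simp: space_measure_of_conv intro!: sigma_sets.Basic)
qed auto

lemma subalgebra_gen_sigma:
  assumes "\<And>i. X i \<in> borel_measurable P"
  shows "subalgebra P (gen_sigma P X I)"
proof -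
  have "(\<Union>i\<in>I. {X i -` B \<inter> space P | B. B \<in> sets borel}) \<subseteq> sets P"
    using measurable_sets[OF assms] by auto
  then show ?thesis
    unfolding subalgebra_def gen_sigma_def
    by (subst sets_measure_of)
      (auto simp: space_measure_of_conv intro: sets.sigma_sets_subset[THEN subsetD])
qed

text \<open>On the reals \<open>Sup\<close> is an upper bound only for bounded sets, so this is what
  makes \<open>mixing_coeff\<close> usable as a bound.\<close>

lemma (in prob_space) bdd_above_mixing:
  "bdd_above {\<bar>prob (A \<inter> B) - prob A * prob B\<bar> | A B n.
     A \<in> sets (gen_sigma M X {1..n}) \<and> B \<in> sets (gen_sigma M X {n + int k..})}"
proof (rule bdd_aboveI[of _ 1])
  fix x assume "x \<in> {\<bar>prob (A \<inter> B) - prob A * prob B\<bar> | A B n.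
     A \<in> sets (gen_sigma M X {1..n}) \<and> B \<in> sets (gen_sigma M X {n + int k..})}"
  then obtain A B where x: "x = \<bar>prob (A \<inter> B) - prob A * prob B\<bar>"
    by blast
  have "0 \<le> prob A * prob B" "prob A * prob B \<le> 1"
    by (auto intro: mult_le_one)
  moreover have "0 \<le> prob (A \<inter> B)" "prob (A \<inter> B) \<le> 1"
    by auto
  ultimately show "x \<le> 1"
    unfolding x by linarith
qed

lemma (in prob_space) mixing_coeff_upper:
  assumes "A \<in> sets (gen_sigma M X {1..n})" "B \<in> sets (gen_sigma M X {n + int k..})"
  shows "\<bar>prob (A \<inter> B) - prob A * prob B\<bar> \<le> mixing_coeff M X k"
  unfolding mixing_coeff_def by (rule cSup_upper[OF _ bdd_above_mixing]) (use assms in blast)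

lemma (in prob_space) mixing_coeff_nonneg: "0 \<le> mixing_coeff M X k"
  using mixing_coeff_upper[of "{}" X 0 "{}" k] by simp

text \<open>This is \<open>C(q)\<close> of the overview. The term with index \<open>k\<close>
  belongs to lag \<open>Suc k\<close>, and the factor 2 counts the neighbours on both sides of an
  index.\<close>

definition cov_sum_bound :: "'a measure \<Rightarrow> (int \<Rightarrow> 'a \<Rightarrow> real) \<Rightarrow> real \<Rightarrow> real" where
  "cov_sum_bound P X q = q + 2 * (\<Sum>k. min (mixing_coeff P X (Suc k)) q)"

lemma (in prob_space) summable_min_mixing:
  assumes "summable (\<lambda>n. mixing_coeff M X (Suc n))" "0 \<le> q"
  shows "summable (\<lambda>k. min (mixing_coeff M X (Suc k)) q)"
  by (rule summable_comparison_test'[OF assms(1)]) (use assms(2) mixing_coeff_nonneg in auto)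

lemma (in prob_space) cov_sum_bound_nonneg:
  assumes "summable (\<lambda>n. mixing_coeff M X (Suc n))" "0 \<le> q"
  shows "0 \<le> cov_sum_bound M X q"
  unfolding cov_sum_bound_def
  using suminf_nonneg[OF summable_min_mixing[OF assms]] mixing_coeff_nonneg assms(2) by auto

text \<open>Tannery's theorem: every term is at most \<open>q n\<close>, and the summable mixing
  coefficients dominate.\<close>

lemma (in prob_space) cov_sum_bound_tendsto_0:
  assumes summ: "summable (\<lambda>n. mixing_coeff M X (Suc n))"
    and q: "q \<longlonglongrightarrow> 0" and nonneg: "\<And>n. 0 \<le> q n"
  shows "(\<lambda>n. cov_sum_bound M X (q n)) \<longlonglongrightarrow> 0"
proof -
  have "(\<lambda>n. min (mixing_coeff M X (Suc k)) (q n)) \<longlonglongrightarrow> 0" for k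
    using tendsto_min[OF tendsto_const[of "mixing_coeff M X (Suc k)"] q] mixing_coeff_nonneg
    by (simp add: min_absorb2)
  moreover have "\<forall>\<^sub>F (k, n) in at_top \<times>\<^sub>F sequentially.
      norm (min (mixing_coeff M X (Suc k)) (q n)) \<le> mixing_coeff M X (Suc k)"
    by (rule always_eventually) (use nonneg mixing_coeff_nonneg in auto)
  ultimately have "(\<lambda>n. \<Sum>k. min (mixing_coeff M X (Suc k)) (q n)) \<longlonglongrightarrow> (\<Sum>k. 0)"
    using tannerys_theorem[of "\<lambda>k n. min (mixing_coeff M X (Suc k)) (q n)" "\<lambda>_. 0" sequentially]
      summ by simp
  then show ?thesis
    unfolding cov_sum_bound_def using q by (auto intro!: tendsto_eq_intros)
qed

text \<open>The covariance is P(A \<inter> B) - P(A) P(B). Mixing bounds it with the past ending at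
  \<open>i\<close>, and dropping the product bounds it by P(A) = q. The condition
  \<open>1 \<le> i\<close> is there because the past in \<open>mixing_coeff\<close> starts at index
  1.\<close>

lemma (in prob_space) indicator_cov_le:
  fixes X :: "int \<Rightarrow> 'a \<Rightarrow> real"
  assumes X: "\<And>i. X i \<in> borel_measurable M" and B: "B \<in> sets borel"
    and q: "\<And>i. prob (X i -` B \<inter> space M) = q" and ij: "1 \<le> i" "i < j"
  shows "expectation (\<lambda>\<omega>. (indicator B (X i \<omega>) - q) * (indicator B (X j \<omega>) - q))
    \<le> min (mixing_coeff M X (nat (j - i))) q"
proof -
  note [measurable] = X B
  let ?A = "\<lambda>i. X i -` B \<inter> space M"
  have [measurable]: "?A i \<in> sets M" for i
    using X B by (rule measurable_sets)
  have "expectation (\<lambda>\<omega>. (indicator B (X i \<omega>) - q) * (indicator B (X j \<omega>) - q))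
    = expectation (\<lambda>\<omega>. indicator (?A i \<inter> ?A j) \<omega> - q * indicator (?A i) \<omega> - q * indicator (?A j) \<omega> + q * q)"
    by (intro Bochner_Integration.integral_cong) (auto simp: indicator_def algebra_simps)
  also have "\<dots> = prob (?A i \<inter> ?A j) - q * prob (?A i) - q * prob (?A j) + q * q"
    by (simp add: integrable_real_indicator prob_space emeasure_eq_measure)
  also have "\<dots> = prob (?A i \<inter> ?A j) - prob (?A i) * prob (?A j)"
    unfolding q by simp
  finally have eq: "expectation (\<lambda>\<omega>. (indicator B (X i \<omega>) - q) * (indicator B (X j \<omega>) - q))
    = prob (?A i \<inter> ?A j) - prob (?A i) * prob (?A j)" .
  have "?A k \<in> sets (gen_sigma M X I)" if "k \<in> I" for k I
    using measurable_sets[OF measurable_gen_sigma[OF that, of X M] B] unfolding gen_sigma_def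
    by (simp add: space_measure_of_conv)
  then have "\<bar>prob (?A i \<inter> ?A j) - prob (?A i) * prob (?A j)\<bar> \<le> mixing_coeff M X (nat (j - i))"
    using ij by (intro mixing_coeff_upper[of _ X i]) auto
  moreover have "prob (?A i \<inter> ?A j) \<le> q"
    unfolding q[of i, symmetric] by (intro finite_measure_mono) auto
  moreover have "0 \<le> q * q"
    by simp
  ultimately show ?thesis
    unfolding eq q by linarith
qed

text \<open>Expanding the square gives one row of covariances per index, and each row is at most
  \<open>cov_sum_bound M X q\<close>. Only distinctness of the indices matters, so the bound also
  covers blocks that wrap around the end of the sample.\<close>

lemma (in prob_space) centred_sum_second_moment:
  fixes X :: "int \<Rightarrow> 'a \<Rightarrow> real"
  assumes X: "\<And>i. X i \<in> borel_measurable M" and B: "B \<in> sets borel"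
    and q: "\<And>i. prob (X i -` B \<inter> space M) = q"
    and summ: "summable (\<lambda>n. mixing_coeff M X (Suc n))"
    and I: "finite I" "I \<subseteq> {1..}"
  shows "expectation (\<lambda>\<omega>. (\<Sum>i\<in>I. indicator B (X i \<omega>) - q)\<^sup>2) \<le> real (card I) * cov_sum_bound M X q"
proof -
  note [measurable] = X B
  define Z where "Z i \<omega> = indicator B (X i \<omega>) - q" for i \<omega>
  have [measurable]: "Z i \<in> borel_measurable M" for i
    unfolding Z_def by measurable
  have q0: "0 \<le> q" "q \<le> 1"
    using q[of 0] measure_nonneg[of M] prob_le_1 by metis+
  have Z1: "\<bar>Z i \<omega>\<bar> \<le> 1" for i \<omega>
    using q0 unfolding Z_def by (auto simp: indicator_def)
  have int: "integrable M (\<lambda>\<omega>. Z i \<omega> * Z j \<omega>)" for i j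
    by (rule integrable_const_bound[of _ 1]) (auto simp: abs_mult intro!: mult_le_one Z1)
  define a where "a k = min (mixing_coeff M X (Suc k)) q" for k
  have a: "summable a" "0 \<le> a k" for k
    unfolding a_def using summable_min_mixing[OF summ q0(1)] q0 mixing_coeff_nonneg by auto
  have diag: "expectation (\<lambda>\<omega>. Z i \<omega> * Z i \<omega>) \<le> q" for i
  proof -
    let ?A = "X i -` B \<inter> space M"
    have [measurable]: "?A \<in> sets M"
      using X B by (rule measurable_sets)
    have "expectation (\<lambda>\<omega>. Z i \<omega> * Z i \<omega>) = expectation (\<lambda>\<omega>. (1 - 2 * q) * indicator ?A \<omega> + q * q)"
      unfolding Z_def by (intro Bochner_Integration.integral_cong) (auto simp: indicator_def algebra_simps)
    also have "\<dots> = (1 - 2 * q) * prob ?A + q * q"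
      by (subst Bochner_Integration.integral_add) (auto intro!: integrable_real_indicator simp: less_top[symmetric] prob_space)
    also have "\<dots> \<le> q"
      unfolding q by (simp add: algebra_simps)
    finally show ?thesis .
  qed
  have off: "expectation (\<lambda>\<omega>. Z i \<omega> * Z j \<omega>) \<le> a (nat (j - i) - 1)" if "1 \<le> i" "i < j" for i j
    using indicator_cov_le[OF X B q that] that unfolding Z_def a_def by simp
  have row: "(\<Sum>j\<in>I. expectation (\<lambda>\<omega>. Z i \<omega> * Z j \<omega>)) \<le> cov_sum_bound M X q" if "i \<in> I" for i
  proof -
    have split: "I = {i} \<union> ({j\<in>I. i < j} \<union> {j\<in>I. j < i})"
      using that by auto
    have "(\<Sum>j\<in>{j\<in>I. i < j}. expectation (\<lambda>\<omega>. Z i \<omega> * Z j \<omega>)) \<le> (\<Sum>j\<in>{j\<in>I. i < j}. a (nat (j - i) - 1))"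
      using I that by (intro sum_mono off) auto
    \<comment> \<open>Distinct indices on one side of \<open>i\<close> have distinct lags, so the
      row is a finite subsum of a series with nonnegative terms.\<close>
    also have "\<dots> = sum a ((\<lambda>j. nat (j - i) - 1) ` {j\<in>I. i < j})"
      by (subst sum.reindex) (auto intro!: inj_onI)
    also have "\<dots> \<le> suminf a"
      using I a by (intro sum_le_suminf) auto
    finally have right: "(\<Sum>j\<in>{j\<in>I. i < j}. expectation (\<lambda>\<omega>. Z i \<omega> * Z j \<omega>)) \<le> suminf a" .
    have "(\<Sum>j\<in>{j\<in>I. j < i}. expectation (\<lambda>\<omega>. Z i \<omega> * Z j \<omega>)) \<le> (\<Sum>j\<in>{j\<in>I. j < i}. a (nat (i - j) - 1))"
      using I that by (intro sum_mono) (subst mult.commute, rule off, auto)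
    also have "\<dots> = sum a ((\<lambda>j. nat (i - j) - 1) ` {j\<in>I. j < i})"
      by (subst sum.reindex) (auto intro!: inj_onI)
    also have "\<dots> \<le> suminf a"
      using I a by (intro sum_le_suminf) auto
    finally have left: "(\<Sum>j\<in>{j\<in>I. j < i}. expectation (\<lambda>\<omega>. Z i \<omega> * Z j \<omega>)) \<le> suminf a" .
    have "(\<Sum>j\<in>I. expectation (\<lambda>\<omega>. Z i \<omega> * Z j \<omega>))
        = expectation (\<lambda>\<omega>. Z i \<omega> * Z i \<omega>) + ((\<Sum>j\<in>{j\<in>I. i < j}. expectation (\<lambda>\<omega>. Z i \<omega> * Z j \<omega>))
          + (\<Sum>j\<in>{j\<in>I. j < i}. expectation (\<lambda>\<omega>. Z i \<omega> * Z j \<omega>)))"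
      using I by (subst split) (subst sum.union_disjoint, auto intro!: sum.union_disjoint)
    then show ?thesis
      using diag[of i] left right unfolding cov_sum_bound_def a_def by simp
  qed
  have "expectation (\<lambda>\<omega>. (\<Sum>i\<in>I. Z i \<omega>)\<^sup>2) = (\<Sum>i\<in>I. \<Sum>j\<in>I. expectation (\<lambda>\<omega>. Z i \<omega> * Z j \<omega>))"
    by (simp add: power2_eq_square sum_product int)
  also have "\<dots> \<le> (\<Sum>i\<in>I. cov_sum_bound M X q)"
    by (intro sum_mono row)
  finally show ?thesis
    unfolding Z_def by simp
qed

subsection \<open>The circular block bootstrap\<close>

text \<open>With factor 1 at all coordinates other than \<open>k\<close>, the summand is a product
  over coordinates and the sum factorises; each other coordinate contributes
  \<open>card S\<close>.\<close>

lemma sum_PiE_component: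
  fixes f :: "'b \<Rightarrow> real"
  assumes "finite K" "finite S" "k \<in> K"
  shows "(\<Sum>j\<in>PiE K (\<lambda>_. S). f (j k)) = real (card S) ^ (card K - 1) * sum f S"
proof -
  have "(\<Sum>j\<in>PiE K (\<lambda>_. S). f (j k)) = (\<Sum>j\<in>PiE K (\<lambda>_. S). \<Prod>m\<in>K. if m = k then f (j m) else 1)"
    using assms by simp
  also have "\<dots> = (\<Prod>m\<in>K. \<Sum>y\<in>S. if m = k then f y else 1)"
    by (rule prod_sum_PiE[symmetric]) (use assms in auto)
  also have "\<dots> = sum f S * (\<Prod>m\<in>K - {k}. \<Sum>y\<in>S. if m = k then f y else 1)"
    using assms by (subst prod.remove[of _ k]) auto
  also have "(\<Prod>m\<in>K - {k}. \<Sum>y\<in>S. if m = k then f y else 1) = (\<Prod>m\<in>K - {k}. real (card S))"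
    by (intro prod.cong) auto
  finally show ?thesis
    using assms by simp
qed

lemma sum_PiE_two_components:
  fixes f g :: "'b \<Rightarrow> real"
  assumes "finite K" "finite S" "k \<in> K" "k' \<in> K" "k \<noteq> k'"
  shows "(\<Sum>j\<in>PiE K (\<lambda>_. S). f (j k) * g (j k')) = real (card S) ^ (card K - 2) * (sum f S * sum g S)"
proof -
  let ?h = "\<lambda>m y. (if m = k then f y else 1) * (if m = k' then g y else 1)"
  have "(\<Sum>j\<in>PiE K (\<lambda>_. S). f (j k) * g (j k')) = (\<Sum>j\<in>PiE K (\<lambda>_. S). \<Prod>m\<in>K. ?h m (j m))"
    using assms by (simp add: prod.distrib)
  also have "\<dots> = (\<Prod>m\<in>K. \<Sum>y\<in>S. ?h m y)"
    by (rule prod_sum_PiE[symmetric]) (use assms in auto)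
  also have "\<dots> = sum f S * (sum g S * (\<Prod>m\<in>K - {k} - {k'}. \<Sum>y\<in>S. ?h m y))"
    using assms by (simp add: prod.remove[of K k] prod.remove[of "K - {k}" k'])
  also have "(\<Prod>m\<in>K - {k} - {k'}. \<Sum>y\<in>S. ?h m y) = (\<Prod>m\<in>K - {k} - {k'}. real (card S))"
    by (intro prod.cong) auto
  finally show ?thesis
    using assms by (simp add: card_Diff_singleton_if numeral_2_eq_2 mult.commute)
qed

text \<open>The left side is the second moment of a sum of \<open>card K\<close> independent uniform
  draws from \<open>S\<close>. The diagonal terms give the mean of s^2 and the others the squared
  mean; the number of the latter is bounded by the square of \<open>card K\<close>.\<close>

lemma sum_PiE_square_le:
  fixes s :: "'b \<Rightarrow> real"
  assumes "finite K" "finite S" "S \<noteq> {}"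
  shows "(\<Sum>j\<in>PiE K (\<lambda>_. S). (\<Sum>k\<in>K. s (j k))\<^sup>2) / real (card S) ^ card K
    \<le> real (card K) / real (card S) * (\<Sum>a\<in>S. (s a)\<^sup>2)
      + (real (card K) / real (card S))\<^sup>2 * (\<Sum>a\<in>S. s a)\<^sup>2"
proof -
  define N where "N = real (card S)"
  define A where "A = (\<Sum>a\<in>S. s a)"
  define Q where "Q = (\<Sum>a\<in>S. (s a)\<^sup>2)"
  define c where "c k k' = (\<Sum>j\<in>PiE K (\<lambda>_. S). s (j k) * s (j k')) / N ^ card K" for k k'
  have N: "N > 0"
    using assms unfolding N_def by (simp add: card_gt_0_iff)
  have diag: "c k k = Q / N" if "k \<in> K" for k
  proof -
    have "card K \<noteq> 0"
      using that assms(1) by auto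
    then have pow: "N ^ card K = N * N ^ (card K - 1)"
      by (cases "card K") auto
    have "(\<Sum>j\<in>PiE K (\<lambda>_. S). s (j k) * s (j k)) = N ^ (card K - 1) * Q"
      using sum_PiE_component[OF assms(1,2) that, of "\<lambda>x. s x * s x"]
      unfolding N_def Q_def power2_eq_square .
    then show ?thesis
      unfolding c_def pow using N by simp
  qed
  have off: "c k k' = (A / N)\<^sup>2" if "k \<in> K" "k' \<in> K" "k \<noteq> k'" for k k'
  proof -
    \<comment> \<open>Two distinct coordinates exist, so the natural number subtraction in
      \<open>card K - 2\<close> is not truncated.\<close>
    have "card {k, k'} \<le> card K"
      using that assms(1) by (intro card_mono) auto
    then have "2 \<le> card K"
      using that by simp
    then obtain d where "card K = 2 + d"
      using le_Suc_ex by blast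
    then have pow: "N ^ card K = N * N * N ^ (card K - 2)"
      by (simp add: power_add power2_eq_square)
    have "(\<Sum>j\<in>PiE K (\<lambda>_. S). s (j k) * s (j k')) = N ^ (card K - 2) * (A * A)"
      using sum_PiE_two_components[OF assms(1,2) that] unfolding N_def A_def .
    then show ?thesis
      unfolding c_def pow using N by (simp add: power2_eq_square)
  qed
  have row: "(\<Sum>k'\<in>K. c k k') \<le> Q / N + real (card K) * (A / N)\<^sup>2" if "k \<in> K" for k
  proof -
    have "(\<Sum>k'\<in>K. c k k') = Q / N + (\<Sum>k'\<in>K - {k}. c k k')"
      using that assms(1) by (subst sum.remove[of _ k]) (simp_all add: diag)
    also have "(\<Sum>k'\<in>K - {k}. c k k') = (\<Sum>k'\<in>K - {k}. (A / N)\<^sup>2)"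
      using that by (intro sum.cong off) auto
    also have "\<dots> \<le> (\<Sum>k'\<in>K. (A / N)\<^sup>2)"
      using assms(1) by (intro sum_mono2) auto
    finally show ?thesis
      by simp
  qed
  have "(\<Sum>j\<in>PiE K (\<lambda>_. S). (\<Sum>k\<in>K. s (j k))\<^sup>2)
      = (\<Sum>k\<in>K. \<Sum>k'\<in>K. \<Sum>j\<in>PiE K (\<lambda>_. S). s (j k) * s (j k'))"
    unfolding power2_eq_square sum_product
    by (simp only: sum.swap[where A = "PiE K (\<lambda>_. S)"])
  then have "(\<Sum>j\<in>PiE K (\<lambda>_. S). (\<Sum>k\<in>K. s (j k))\<^sup>2) / N ^ card K = (\<Sum>k\<in>K. \<Sum>k'\<in>K. c k k')"
    unfolding c_def by (simp add: sum_divide_distrib)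
  also have "\<dots> \<le> (\<Sum>k\<in>K. Q / N + real (card K) * (A / N)\<^sup>2)"
    by (intro sum_mono row)
  also have "\<dots> = real (card K) / N * Q + (real (card K) / N)\<^sup>2 * A\<^sup>2"
    by (simp add: field_simps power2_eq_square)
  finally show ?thesis
    unfolding N_def A_def Q_def .
qed

section \<open>Periodic indices and the block structure of positions\<close>

lemma wrap_index_range: "1 \<le> n \<Longrightarrow> wrap_index n m \<in> {1..n}"
  by (simp add: wrap_index_def Suc_le_eq)

text \<open>Equal residues would make \<open>n\<close> divide \<open>j - i\<close>, which lies
  strictly between 0 and \<open>n\<close>.\<close>

lemma wrap_index_neq:
  assumes "1 \<le> i" "i < j" "j < i + n"
  shows "wrap_index n i \<noteq> wrap_index n j"
proof
  assume "wrap_index n i = wrap_index n j"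
  then have "(j - 1) mod n = (i - 1) mod n"
    by (simp add: wrap_index_def)
  then have "n dvd (j - 1) - (i - 1)"
    using assms by (subst mod_eq_dvd_iff_nat[symmetric]) auto
  moreover have "(j - 1) - (i - 1) = j - i"
    using assms by simp
  ultimately show False
    using assms by (auto dest!: dvd_imp_le)
qed

text \<open>A block no longer than the sample meets no observation twice, as the second moment bound
  for sums over index sets requires.\<close>

lemma inj_on_wrap_index_offset:
  assumes "1 \<le> a" "l \<le> n"
  shows "inj_on (\<lambda>r. wrap_index n (a + r)) {..<l}"
  by (rule linorder_inj_onI', rule wrap_index_neq) (use assms in auto)

text \<open>This is the gain from circularity: at a fixed offset, each observation is reached from
  exactly one start, so that averaging over all starts weighs the observations equally.\<close>

lemma bij_betw_wrap_index_start:
  assumes "1 \<le> n"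
  shows "bij_betw (\<lambda>a. wrap_index n (a + r)) {1..n} {1..n}"
proof -
  have inj: "inj_on (\<lambda>a. wrap_index n (a + r)) {1..n}"
    by (rule linorder_inj_onI', rule wrap_index_neq) auto
  have "(\<lambda>a. wrap_index n (a + r)) ` {1..n} \<subseteq> {1..n}"
    using wrap_index_range[OF assms] by blast
  then have "(\<lambda>a. wrap_index n (a + r)) ` {1..n} = {1..n}"
    using endo_inj_surj[OF _ _ inj] by blast
  then show ?thesis
    using inj by (simp add: bij_betw_def)
qed

lemma sum_blocks:
  fixes g :: "nat \<Rightarrow> nat \<Rightarrow> 'b::comm_monoid_add"
  assumes "1 \<le> l"
  shows "(\<Sum>i = 1..b * l. g ((i - 1) div l) ((i - 1) mod l)) = (\<Sum>k<b. \<Sum>r<l. g k r)"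
proof -
  have "(\<Sum>i = 1..b * l. g ((i - 1) div l) ((i - 1) mod l)) = (\<Sum>i<b * l. g (i div l) (i mod l))"
    by (rule sum.reindex_bij_witness[of _ Suc "\<lambda>i. i - 1"]) auto
  also have "\<dots> = (\<Sum>k<b. \<Sum>i = k * l..<k * l + l. g (i div l) (i mod l))"
    by (rule sum.nat_group[symmetric])
  also have "\<dots> = (\<Sum>k<b. \<Sum>r<l. g k r)"
  proof (rule sum.cong[OF refl])
    fix k
    show "(\<Sum>i = k * l..<k * l + l. g (i div l) (i mod l)) = (\<Sum>r<l. g k r)"
      using assms sum.shift_bounds_nat_ivl[of "\<lambda>i. g (i div l) (i mod l)" 0 "k * l" l]
      by (simp add: add.commute lessThan_atLeast0)
  qed
  finally show ?thesis .
qed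

text \<open>Integrates out the resampling. Since \<open>f j\<close> is determined by the data, the
  indicator of the event that the starts equal \<open>j\<close> may be replaced by its conditional
  probability, which is 1 / n^b almost surely for \<open>b\<close> blocks. Restricting the random
  starts to \<open>{..<n div l n}\<close> makes them an element of the finite extensional function
  space.\<close>

lemma (in prob_space) cbb_expectation:
  assumes X: "\<And>i. X i \<in> borel_measurable M" and cbb: "cbb_start_indices M X l J" and n: "1 \<le> n"
    and f: "\<And>j. f j \<in> borel_measurable (gen_sigma M X {1..})" and bdd: "\<And>j \<omega>. \<bar>f j \<omega>\<bar> \<le> (c::real)"
  shows "expectation (\<lambda>\<omega>. f (\<lambda>k\<in>{..<n div l n}. J n k \<omega>) \<omega>)
    = (\<Sum>j\<in>{..<n div l n} \<rightarrow>\<^sub>E {1..n}. expectation (f j)) / real n ^ (n div l n)"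
proof -
  define b where "b = n div l n"
  let ?G = "gen_sigma M X {1..}"
  have sub: "subalgebra M ?G"
    by (rule subalgebra_gen_sigma) (rule X)
  interpret G: finite_measure_subalgebra M ?G
    by standard (rule sub)
  have [measurable]: "f j \<in> borel_measurable M" for j
    by (rule measurable_from_subalg[OF sub f])
  have Jm: "J n k \<in> measurable M (count_space {1..n})" if "k < b" for k
    using cbb n that unfolding cbb_start_indices_def b_def by blast
  let ?E = "\<lambda>j. {\<omega> \<in> space M. \<forall>k<b. J n k \<omega> = j k}"
  have E: "?E j \<in> sets M" for j :: "nat \<Rightarrow> nat"
  proof -
    have coord: "{\<omega> \<in> space M. J n k \<omega> = j k} \<in> sets M" if "k < b" for k
    proof -
      \<comment> \<open>Here \<open>j\<close> is arbitrary, while the measurable sets of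
        \<open>count_space {1..n}\<close> are the subsets of \<open>{1..n}\<close>; hence the
        intersection.\<close>
      have "{\<omega> \<in> space M. J n k \<omega> = j k} = J n k -` ({j k} \<inter> {1..n}) \<inter> space M"
        using measurable_space[OF Jm[OF that]] by fastforce
      then show ?thesis
        using measurable_sets[OF Jm[OF that], of "{j k} \<inter> {1..n}"] by simp
    qed
    have "{\<omega> \<in> space M. \<forall>k\<in>{..<b}. J n k \<omega> = j k} \<in> sets M"
      by (rule sets.sets_Collect_finite_All) (simp_all add: coord)
    then show ?thesis
      by (simp only: Ball_def lessThan_iff)
  qed
  have int: "integrable M (\<lambda>\<omega>. f j \<omega> * indicator (?E j) \<omega>)" for j
  proof (rule integrable_const_bound[of _ c])
    have "norm (f j \<omega> * indicator A \<omega>) \<le> c" for A \<omega>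
      using bdd[of j \<omega>] by (auto simp: indicator_def)
    then show "AE \<omega> in M. norm (f j \<omega> * indicator (?E j) \<omega>) \<le> c"
      by (intro AE_I2)
    show "(\<lambda>\<omega>. f j \<omega> * indicator (?E j) \<omega>) \<in> borel_measurable M"
      by (intro borel_measurable_times borel_measurable_indicator E) measurable
  qed
  have point: "expectation (\<lambda>\<omega>. f j \<omega> * indicator (?E j) \<omega>) = expectation (f j) / real n ^ b"
    if j: "j \<in> {..<b} \<rightarrow>\<^sub>E {1..n}" for j
  proof -
    have j': "j \<in> {..<b} \<rightarrow> {1..n}"
      using j by auto
    have "AE \<omega> in M. P_star M X {\<omega>' \<in> space M. J n k \<omega>' = j k} \<omega> = 1 / real n" if "k \<in> {..<b}" for k
    proof -
      have "k < n div l n" "j k \<in> {1..n}"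
        using j' that unfolding b_def by auto
      then show ?thesis
        using cbb n unfolding cbb_start_indices_def by blast
    qed
    then have "AE \<omega> in M. \<forall>k\<in>{..<b}. P_star M X {\<omega>' \<in> space M. J n k \<omega>' = j k} \<omega> = 1 / real n"
      by (rule AE_ball_countable') auto
    moreover have "AE \<omega> in M. P_star M X (?E j) \<omega> = (\<Prod>k<b. P_star M X {\<omega>' \<in> space M. J n k \<omega>' = j k} \<omega>)"
      using cbb n j' unfolding cbb_start_indices_def b_def by blast
    ultimately have ae: "AE \<omega> in M. P_star M X (?E j) \<omega> = 1 / real n ^ b"
      by eventually_elim (simp add: power_one_over)
    have "expectation (\<lambda>\<omega>. f j \<omega> * indicator (?E j) \<omega>)
        = expectation (\<lambda>\<omega>. f j \<omega> * P_star M X (?E j) \<omega>)"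
      unfolding P_star_def by (rule G.real_cond_exp_intg(2)[symmetric, OF int f borel_measurable_indicator[OF E]])
    also have "\<dots> = expectation (\<lambda>\<omega>. f j \<omega> * (1 / real n ^ b))"
      using ae unfolding P_star_def by (intro integral_cong_AE) auto
    finally show ?thesis
      by simp
  qed
  \<comment> \<open>Exactly one extensional \<open>j\<close> agrees with the observed starts, so a
    single summand survives.\<close>
  have "f (\<lambda>k\<in>{..<b}. J n k \<omega>) \<omega> = (\<Sum>j\<in>{..<b} \<rightarrow>\<^sub>E {1..n}. f j \<omega> * indicator (?E j) \<omega>)"
    if "\<omega> \<in> space M" for \<omega>
  proof -
    let ?j = "\<lambda>k\<in>{..<b}. J n k \<omega>"
    have mem: "?j \<in> {..<b} \<rightarrow>\<^sub>E {1..n}"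
      using measurable_space[OF Jm that] by auto
    have "indicator (?E j) \<omega> = (if j = ?j then 1 else 0 :: real)" if "j \<in> {..<b} \<rightarrow>\<^sub>E {1..n}" for j
    proof -
      have "(\<forall>k<b. J n k \<omega> = j k) \<longleftrightarrow> j = ?j"
      proof
        assume "\<forall>k<b. J n k \<omega> = j k"
        then show "j = ?j"
          using that by (intro PiE_ext[OF that mem]) simp
      qed auto
      then show ?thesis
        using \<open>\<omega> \<in> space M\<close> by (simp add: indicator_def)
    qed
    then have "(\<Sum>j\<in>{..<b} \<rightarrow>\<^sub>E {1..n}. f j \<omega> * indicator (?E j) \<omega>)
      = (\<Sum>j\<in>{..<b} \<rightarrow>\<^sub>E {1..n}. if j = ?j then f j \<omega> else 0)"
      by (intro sum.cong) auto
    also have "\<dots> = f ?j \<omega>"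
      using mem by (simp add: finite_PiE)
    finally show ?thesis ..
  qed
  then have "expectation (\<lambda>\<omega>. f (\<lambda>k\<in>{..<b}. J n k \<omega>) \<omega>)
      = expectation (\<lambda>\<omega>. \<Sum>j\<in>{..<b} \<rightarrow>\<^sub>E {1..n}. f j \<omega> * indicator (?E j) \<omega>)"
    by (intro Bochner_Integration.integral_cong) auto
  also have "\<dots> = (\<Sum>j\<in>{..<b} \<rightarrow>\<^sub>E {1..n}. expectation (\<lambda>\<omega>. f j \<omega> * indicator (?E j) \<omega>))"
    by (rule Bochner_Integration.integral_sum) (rule int)
  also have "\<dots> = (\<Sum>j\<in>{..<b} \<rightarrow>\<^sub>E {1..n}. expectation (f j)) / real n ^ b"
    by (simp add: point sum_divide_distrib)
  finally show ?thesis
    unfolding b_def .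
qed

text \<open>Given the data, the block sums \<open>s\<close> at the random starts are independent and
  uniformly chosen, so \<open>sum_PiE_square_le\<close> applies. Its first term is controlled by the
  variance of one block, its second by that of the whole sample. With N = b m resampled points the
  squared sum has mean at most N C + N^2 C / n; division by N^2 and n \<le> 2 N give 2 C / n + C /
  n.\<close>

lemma (in prob_space) boot_frequency_second_moment:
  fixes X :: "int \<Rightarrow> 'a \<Rightarrow> real"
  assumes X: "\<And>i. X i \<in> borel_measurable M" and B: "B \<in> sets borel"
    and q: "\<And>i. prob (X i -` B \<inter> space M) = q"
    and summ: "summable (\<lambda>n. mixing_coeff M X (Suc n))"
    and cbb: "cbb_start_indices M X l J" and n: "1 \<le> n" and ln: "l n \<in> {1..n}"
  shows "expectation (\<lambda>\<omega>. ((\<Sum>i = 1..n div l n * l n. indicator B (boot_sample X l J n i \<omega>) - q)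
      / real (n div l n * l n))\<^sup>2) \<le> 3 * cov_sum_bound M X q / real n"
proof -
  define b where "b = n div l n"
  define m where "m = l n"
  define C where "C = cov_sum_bound M X q"
  define Z where "Z i \<omega> = indicator B (X i \<omega>) - q" for i \<omega>
  define s where "s a \<omega> = (\<Sum>r<m. Z (int (wrap_index n (a + r))) \<omega>)" for a \<omega>
  define f where "f j \<omega> = (\<Sum>k<b. s (j k) \<omega>)\<^sup>2" for j :: "nat \<Rightarrow> nat" and \<omega>
  have q0: "0 \<le> q" "q \<le> 1"
    using q[of 0] measure_nonneg[of M] prob_le_1 by metis+
  have C: "0 \<le> C"
    unfolding C_def by (rule cov_sum_bound_nonneg[OF summ q0(1)])
  have m: "1 \<le> m" "m \<le> n"
    using ln unfolding m_def by auto
  have b: "1 \<le> b"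
    using m unfolding b_def m_def by (simp add: Suc_le_eq div_greater_zero_iff)
  have ZG: "Z i \<in> borel_measurable (gen_sigma M X {1..})" if "1 \<le> i" for i
    unfolding Z_def using measurable_gen_sigma[of i "{1..}" X M] that B by simp
  have sG [measurable]: "s a \<in> borel_measurable (gen_sigma M X {1..})" for a
    unfolding s_def using wrap_index_range[OF n] by (intro borel_measurable_sum ZG) auto
  have fG: "f j \<in> borel_measurable (gen_sigma M X {1..})" for j
    unfolding f_def by measurable
  have sub: "subalgebra M (gen_sigma M X {1..})"
    by (rule subalgebra_gen_sigma) (rule X)
  have [measurable]: "s a \<in> borel_measurable M" for a
    by (rule measurable_from_subalg[OF sub sG])
  have [measurable]: "f j \<in> borel_measurable M" for j
    by (rule measurable_from_subalg[OF sub fG])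
  have Z1: "\<bar>Z i \<omega>\<bar> \<le> 1" for i \<omega>
    using q0 unfolding Z_def by (auto simp: indicator_def)
  have s1: "\<bar>s a \<omega>\<bar> \<le> real m" for a \<omega>
    using sum_norm_bound[of "{..<m}" "\<lambda>r. Z (int (wrap_index n (a + r))) \<omega>" 1] Z1
    unfolding s_def by simp
  have sums1: "\<bar>\<Sum>k\<in>K. s (j k) \<omega>\<bar> \<le> real (card K) * real m" for K and j :: "nat \<Rightarrow> nat" and \<omega>
    using sum_norm_bound[of K "\<lambda>k. s (j k) \<omega>" "real m"] s1 by simp
  have sq: "x\<^sup>2 \<le> c\<^sup>2" if "\<bar>x\<bar> \<le> c" for x c :: real
    using that by (rule abs_le_square_iff[THEN iffD1, OF order_trans[OF _ abs_ge_self]])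
  have f1: "\<bar>f j \<omega>\<bar> \<le> (real b * real m)\<^sup>2" for j \<omega>
  proof -
    have "\<bar>\<Sum>k<b. s (j k) \<omega>\<bar> \<le> real (card {..<b}) * real m"
      by (rule sums1)
    then show ?thesis
      using sq unfolding f_def by simp
  qed
  have int_f: "integrable M (f j)" for j
    by (rule integrable_const_bound[of _ "(real b * real m)\<^sup>2"]) (use f1 in auto)
  have int_s: "integrable M (\<lambda>\<omega>. (s a \<omega>)\<^sup>2)" for a
    by (rule integrable_const_bound[of _ "(real m)\<^sup>2"]) (use sq[OF s1] in auto)
  have int_sum: "integrable M (\<lambda>\<omega>. (\<Sum>a\<in>{1..n}. s a \<omega>)\<^sup>2)"
  proof (rule integrable_const_bound[of _ "(real (card {1..n}) * real m)\<^sup>2"])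
    have "(\<Sum>a\<in>{1..n}. s a \<omega>)\<^sup>2 \<le> (real (card {1..n}) * real m)\<^sup>2" for \<omega>
      by (intro sq sums1)
    then show "AE \<omega> in M. norm ((\<Sum>a\<in>{1..n}. s a \<omega>)\<^sup>2) \<le> (real (card {1..n}) * real m)\<^sup>2"
      by simp
  qed measurable
  have block: "expectation (\<lambda>\<omega>. (s a \<omega>)\<^sup>2) \<le> real m * C" if "a \<in> {1..n}" for a
  proof -
    let ?w = "\<lambda>r. int (wrap_index n (a + r))"
    have inj: "inj_on ?w {..<m}"
      using inj_on_wrap_index_offset[of a m n] that m by (auto simp: inj_on_def)
    have "s a = (\<lambda>\<omega>. \<Sum>i\<in>?w ` {..<m}. indicator B (X i \<omega>) - q)"
      using inj unfolding s_def Z_def by (simp add: sum.reindex)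
    moreover have "card (?w ` {..<m}) = m"
      using inj by (simp add: card_image)
    moreover have "?w ` {..<m} \<subseteq> {1..}"
      using wrap_index_range[OF n] by auto
    ultimately show ?thesis
      using centred_sum_second_moment[OF X B q summ, of "?w ` {..<m}"] unfolding C_def by simp
  qed
  have total: "expectation (\<lambda>\<omega>. (\<Sum>a\<in>{1..n}. s a \<omega>)\<^sup>2) \<le> (real m)\<^sup>2 * (real n * C)"
  proof -
    \<comment> \<open>After exchanging the sums, each of the \<open>m\<close> offsets runs once
      through the whole sample.\<close>
    have "(\<Sum>a\<in>{1..n}. s a \<omega>) = real m * (\<Sum>i\<in>int ` {1..n}. indicator B (X i \<omega>) - q)" for \<omega>
    proof -
      have "(\<Sum>a\<in>{1..n}. s a \<omega>) = (\<Sum>r<m. \<Sum>a\<in>{1..n}. Z (int (wrap_index n (a + r))) \<omega>)"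
        unfolding s_def by (rule sum.swap)
      also have "\<dots> = (\<Sum>r<m. \<Sum>a\<in>{1..n}. Z (int a) \<omega>)"
        by (intro sum.cong refl sum.reindex_bij_betw[OF bij_betw_wrap_index_start[OF n]])
      also have "\<dots> = real m * (\<Sum>i\<in>int ` {1..n}. Z i \<omega>)"
        by (subst sum.reindex) auto
      finally show ?thesis
        unfolding Z_def .
    qed
    then have "expectation (\<lambda>\<omega>. (\<Sum>a\<in>{1..n}. s a \<omega>)\<^sup>2)
      = (real m)\<^sup>2 * expectation (\<lambda>\<omega>. (\<Sum>i\<in>int ` {1..n}. indicator B (X i \<omega>) - q)\<^sup>2)"
      by (simp add: power_mult_distrib)
    also have "\<dots> \<le> (real m)\<^sup>2 * (real n * C)"
      using centred_sum_second_moment[OF X B q summ, of "int ` {1..n}", OF _ image_subsetI] unfolding C_def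
      by (intro mult_left_mono) (auto simp: card_image)
    finally show ?thesis .
  qed
  have boot: "(\<Sum>i = 1..b * m. indicator B (boot_sample X l J n i \<omega>) - q)\<^sup>2
      = f (\<lambda>k\<in>{..<b}. J n k \<omega>) \<omega>" for \<omega>
    using sum_blocks[OF m(1), of "\<lambda>k r. Z (int (wrap_index n (J n k \<omega> + r))) \<omega>" b]
    unfolding f_def s_def Z_def boot_sample_def m_def by simp
  have "expectation (\<lambda>\<omega>. f (\<lambda>k\<in>{..<b}. J n k \<omega>) \<omega>)
      = (\<Sum>j\<in>{..<b} \<rightarrow>\<^sub>E {1..n}. expectation (f j)) / real n ^ b"
    using cbb_expectation[OF X cbb n fG f1] unfolding b_def .
  also have "\<dots> = expectation (\<lambda>\<omega>. (\<Sum>j\<in>{..<b} \<rightarrow>\<^sub>E {1..n}. f j \<omega>) / real n ^ b)"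
    using int_f by simp
  also have "\<dots> \<le> expectation (\<lambda>\<omega>. real b / real n * (\<Sum>a\<in>{1..n}. (s a \<omega>)\<^sup>2)
      + (real b / real n)\<^sup>2 * (\<Sum>a\<in>{1..n}. s a \<omega>)\<^sup>2)"
  proof (rule integral_mono)
    show "(\<Sum>j\<in>{..<b} \<rightarrow>\<^sub>E {1..n}. f j \<omega>) / real n ^ b
      \<le> real b / real n * (\<Sum>a\<in>{1..n}. (s a \<omega>)\<^sup>2) + (real b / real n)\<^sup>2 * (\<Sum>a\<in>{1..n}. s a \<omega>)\<^sup>2" for \<omega>
      using sum_PiE_square_le[of "{..<b}" "{1..n}" "\<lambda>a. s a \<omega>"] n unfolding f_def by simp
  qed (use int_f int_s int_sum in auto)
  also have "\<dots> = real b / real n * (\<Sum>a\<in>{1..n}. expectation (\<lambda>\<omega>. (s a \<omega>)\<^sup>2))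
      + (real b / real n)\<^sup>2 * expectation (\<lambda>\<omega>. (\<Sum>a\<in>{1..n}. s a \<omega>)\<^sup>2)"
    using int_s int_sum by simp
  also have "\<dots> \<le> real b / real n * (\<Sum>a\<in>{1..n}. real m * C)
      + (real b / real n)\<^sup>2 * ((real m)\<^sup>2 * (real n * C))"
    using block total by (intro add_mono mult_left_mono sum_mono) auto
  also have "\<dots> = real (b * m) * C + (real (b * m))\<^sup>2 * C / real n"
    using n by (simp add: power2_eq_square field_simps)
  finally have moment: "expectation (\<lambda>\<omega>. f (\<lambda>k\<in>{..<b}. J n k \<omega>) \<omega>)
    \<le> real (b * m) * C + (real (b * m))\<^sup>2 * C / real n" .
  have pos: "0 < real (b * m)"
    using b m by simp
  \<comment> \<open>Fewer than \<open>l n \<le> b * l n\<close> observations are cut off.\<close>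
  have "n < b * m + m"
    using m dividend_less_div_times[of m n] unfolding b_def m_def by simp
  moreover have "m \<le> b * m"
    using b by simp
  ultimately have "n \<le> 2 * (b * m)"
    by linarith
  then have half: "real n \<le> 2 * real (b * m)"
    by (metis of_nat_le_iff of_nat_mult of_nat_numeral)
  have "expectation (\<lambda>\<omega>. ((\<Sum>i = 1..b * m. indicator B (boot_sample X l J n i \<omega>) - q)
      / real (b * m))\<^sup>2) = expectation (\<lambda>\<omega>. f (\<lambda>k\<in>{..<b}. J n k \<omega>) \<omega>) / (real (b * m))\<^sup>2"
    by (simp only: power_divide boot Bochner_Integration.integral_divide_zero)
  also have "\<dots> \<le> (real (b * m) * C + (real (b * m))\<^sup>2 * C / real n) / (real (b * m))\<^sup>2"
    by (intro divide_right_mono moment) simp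
  also have "\<dots> = C / real (b * m) + C / real n"
    using pos by (simp add: add_divide_distrib power2_eq_square del: of_nat_mult)
  also have "C / real (b * m) \<le> 2 * C / real n"
    using mult_left_mono[OF half C] pos n by (simp add: divide_le_eq field_simps)
  finally show ?thesis
    unfolding b_def m_def C_def by simp
qed

section \<open>The bootstrap distribution function: quantile, measurability and deviation
  bounds\<close>

lemma boot_ecdf_mono: "mono (boot_ecdf X l J n \<omega>)"
  unfolding boot_ecdf_def
  by (intro monoI divide_right_mono sum_mono) (auto simp: indicator_def)

lemma boot_ecdf_right_cont: "continuous (at_right t) (boot_ecdf X l J n \<omega>)"
proof -
  have "continuous (at_right t) (\<lambda>t. indicator {..t} x :: real)" for x :: real
  proof (cases "x \<le> t")
    case True
    then have "\<forall>\<^sub>F u in at_right t. indicator {..u} x = (indicator {..t} x :: real)"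
      unfolding eventually_at_right_field by (intro exI[of _ "t + 1"]) auto
    then show ?thesis
      unfolding continuous_within by (rule tendsto_eventually)
  next
    case False
    then have "\<forall>\<^sub>F u in at_right t. indicator {..u} x = (indicator {..t} x :: real)"
      unfolding eventually_at_right_field by (intro exI[of _ x]) auto
    then show ?thesis
      unfolding continuous_within by (rule tendsto_eventually)
  qed
  then show ?thesis
    unfolding boot_ecdf_def divide_inverse by (intro continuous_intros)
qed

lemma boot_ecdf_at_bot: "(boot_ecdf X l J n \<omega> \<longlongrightarrow> 0) at_bot"
proof -
  have "((\<lambda>t. indicator {..t} x :: real) \<longlongrightarrow> 0) at_bot" for x :: real
    using eventually_gt_at_bot[of x]
    by (intro tendsto_eventually) (auto elim!: eventually_mono simp: indicator_def not_le)
  then show ?thesis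
    unfolding boot_ecdf_def divide_inverse
    by (intro tendsto_mult_left_zero tendsto_null_sum)
qed

text \<open>The range of \<open>l n\<close> guarantees at least one block; for an empty resample,
  division by 0 would make the function constantly 0.\<close>

lemma boot_ecdf_at_top:
  assumes "1 \<le> n" "l n \<in> {1..n}"
  shows "(boot_ecdf X l J n \<omega> \<longlongrightarrow> 1) at_top"
proof -
  have "((\<lambda>t. indicator {..t} x :: real) \<longlongrightarrow> 1) at_top" for x :: real
    using eventually_ge_at_top[of x]
    by (intro tendsto_eventually) (auto elim!: eventually_mono simp: indicator_def)
  then have "(boot_ecdf X l J n \<omega> \<longlongrightarrow> (\<Sum>i = 1..n div l n * l n. 1) / real (n div l n * l n)) at_top"
    unfolding boot_ecdf_def divide_inverse by (intro tendsto_intros)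
  moreover have "0 < n div l n * l n"
    using assms by (simp add: div_greater_zero_iff)
  ultimately show ?thesis
    by (simp del: of_nat_mult)
qed

lemma boot_quantile_le_iff:
  assumes "1 \<le> n" "l n \<in> {1..n}" "0 < p" "p < 1"
  shows "quantile (boot_ecdf X l J n \<omega>) p \<le> t \<longleftrightarrow> p \<le> boot_ecdf X l J n \<omega> t"
  using assms
  by (intro quantile_le_iff boot_ecdf_mono boot_ecdf_right_cont boot_ecdf_at_bot boot_ecdf_at_top)

text \<open>A measurable family evaluated at a random index with countably many values is
  measurable. The range of \<open>i\<close> ensures that its block is one of those that
  \<open>cbb_start_indices\<close> speaks of.\<close>

lemma boot_sample_measurable:
  assumes X: "\<And>i. X i \<in> borel_measurable P" and cbb: "cbb_start_indices P X l J"
    and i: "i \<in> {1..n div l n * l n}"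
  shows "boot_sample X l J n i \<in> borel_measurable P"
proof -
  define k where "k = (i - 1) div l n"
  have "i - 1 < n div l n * l n"
    using i by auto
  then have k: "k < n div l n"
    unfolding k_def by (rule less_mult_imp_div_less)
  moreover from this have "1 \<le> n"
    by (cases n) auto
  ultimately have J: "J n k \<in> measurable P (count_space {1..n})"
    using cbb unfolding cbb_start_indices_def by blast
  have "(\<lambda>\<omega>. X (int (wrap_index n (J n k \<omega> + (i - 1) mod l n))) \<omega>) \<in> borel_measurable P"
    by (rule measurable_compose_countable'[OF X J]) auto
  then show ?thesis
    unfolding boot_sample_def k_def .
qed

lemma boot_ecdf_measurable:
  assumes "\<And>i. X i \<in> borel_measurable P" "cbb_start_indices P X l J"
  shows "(\<lambda>\<omega>. boot_ecdf X l J n \<omega> t) \<in> borel_measurable P"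
  unfolding boot_ecdf_def
  by (intro borel_measurable_divide borel_measurable_sum borel_measurable_const
      measurable_compose[OF boot_sample_measurable[OF assms]] borel_measurable_indicator) auto

text \<open>By \<open>boot_quantile_le_iff\<close> the sublevel sets of the quantile are events
  about the distribution function at a fixed point.\<close>

lemma boot_quantile_measurable:
  assumes "\<And>i. X i \<in> borel_measurable P" "cbb_start_indices P X l J"
    and "1 \<le> n" "l n \<in> {1..n}" "0 < p" "p < 1"
  shows "(\<lambda>\<omega>. quantile (boot_ecdf X l J n \<omega>) p) \<in> borel_measurable P"
proof -
  note [measurable] = boot_ecdf_measurable[OF assms(1,2)]
  show ?thesis
    unfolding borel_measurable_iff_le boot_quantile_le_iff[of n l p, OF assms(3-6)] by measurable
qed

text \<open>Chebyshev's inequality; the scaling by the root of \<open>n\<close> cancels the factor 1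
  / n of the second moment bound, so the result does not depend on \<open>n\<close>.\<close>

lemma (in prob_space) boot_frequency_deviation:
  fixes X :: "int \<Rightarrow> 'a \<Rightarrow> real"
  assumes X: "\<And>i. X i \<in> borel_measurable M" and B: "B \<in> sets borel"
    and q: "\<And>i. prob (X i -` B \<inter> space M) = q"
    and summ: "summable (\<lambda>n. mixing_coeff M X (Suc n))"
    and cbb: "cbb_start_indices M X l J" and n: "1 \<le> n" and ln: "l n \<in> {1..n}" and a: "0 < a"
  shows "prob {\<omega> \<in> space M. a \<le> sqrt (real n) *
      \<bar>(\<Sum>i = 1..n div l n * l n. indicator B (boot_sample X l J n i \<omega>)) / real (n div l n * l n) - q\<bar>}
    \<le> 3 * cov_sum_bound M X q / a\<^sup>2"
proof -
  define N where "N = n div l n * l n"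
  define Y where "Y \<omega> = (\<Sum>i = 1..N. indicator B (boot_sample X l J n i \<omega>) - q) / real N" for \<omega>
  have N: "0 < N"
    unfolding N_def using n ln by (simp add: div_greater_zero_iff)
  have Y_eq: "(\<Sum>i = 1..N. indicator B (boot_sample X l J n i \<omega>)) / real N - q = Y \<omega>" for \<omega>
    unfolding Y_def using N by (simp add: sum_subtractf diff_divide_distrib)
  have q0: "0 \<le> q" "q \<le> 1"
    using q[of 0] measure_nonneg[of M] prob_le_1 by metis+
  have [measurable]: "Y \<in> borel_measurable M"
    unfolding Y_def N_def
    by (intro borel_measurable_divide borel_measurable_sum borel_measurable_diff borel_measurable_const
      measurable_compose[OF boot_sample_measurable[OF X cbb]] borel_measurable_indicator B) auto
  have "norm (\<Sum>i = 1..N. indicator B (boot_sample X l J n i \<omega>) - q) \<le> real (card {1..N}) * 1" for \<omega>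
    using q0 by (intro sum_norm_bound) (auto simp: indicator_def)
  then have "\<bar>Y \<omega>\<bar> \<le> 1" for \<omega>
    using N unfolding Y_def by (simp add: divide_le_eq)
  then have int: "integrable M (\<lambda>\<omega>. (Y \<omega>)\<^sup>2)"
    by (intro integrable_const_bound[of _ 1]) (auto simp: abs_square_le_1)
  have "prob {\<omega> \<in> space M. a \<le> sqrt (real n) * \<bar>Y \<omega>\<bar>} = prob {\<omega> \<in> space M. a / sqrt (real n) \<le> \<bar>Y \<omega>\<bar>}"
    using n by (intro arg_cong[where f = prob]) (auto simp: field_simps)
  also have "\<dots> \<le> expectation (\<lambda>\<omega>. (Y \<omega>)\<^sup>2) / (a / sqrt (real n))\<^sup>2"
    using int a n by (intro second_moment_method) auto
  also have "\<dots> \<le> (3 * cov_sum_bound M X q / real n) / (a / sqrt (real n))\<^sup>2"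
    using boot_frequency_second_moment[OF X B q summ cbb n ln] unfolding Y_def N_def
    by (intro divide_right_mono) auto
  also have "\<dots> = 3 * cov_sum_bound M X q / a\<^sup>2"
    using n a by (simp add: power_divide)
  finally show ?thesis
    unfolding Y_eq[unfolded N_def] by (simp add: N_def)
qed

text \<open>An increment is the bootstrap frequency of a half-open interval. Both orders of
  \<open>u\<close> and \<open>v\<close> are covered, because \<open>t\<^sub>p\<close> is later
  approached from either side.\<close>

lemma (in prob_space) boot_ecdf_increment_deviation:
  fixes X :: "int \<Rightarrow> 'a \<Rightarrow> real"
  assumes X: "\<And>i. X i \<in> borel_measurable M" and F: "\<And>i. F = cdf (distr M borel (X i))"
    and summ: "summable (\<lambda>n. mixing_coeff M X (Suc n))"
    and cbb: "cbb_start_indices M X l J" and n: "1 \<le> n" and ln: "l n \<in> {1..n}" and a: "0 < a"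
  shows "prob {\<omega> \<in> space M. a \<le> sqrt (real n) *
      \<bar>boot_ecdf X l J n \<omega> v - boot_ecdf X l J n \<omega> u - (F v - F u)\<bar>}
    \<le> 3 * cov_sum_bound M X \<bar>F v - F u\<bar> / a\<^sup>2"
proof (induction u v rule: linorder_wlog)
  case (le u v)
  have diff: "prob (X i -` {u<..v} \<inter> space M) = F v - F u" for i
  proof -
    interpret D: real_distribution "distr M borel (X i)"
      using X by (rule real_distribution_distr)
    have "measure (distr M borel (X i)) {u<..v} = F v - F u"
    proof (cases "u = v")
      case False
      then show ?thesis
        using le D.cdf_diff_eq[of u v] F[of i] by simp
    qed simp
    then show ?thesis
      using X by (simp add: measure_distr)
  qed
  have "boot_ecdf X l J n \<omega> v - boot_ecdf X l J n \<omega> u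
    = (\<Sum>i = 1..n div l n * l n. indicator {u<..v} (boot_sample X l J n i \<omega>)) / real (n div l n * l n)" for \<omega>
  proof -
    have "indicator {..v} x - indicator {..u} x = (indicator {u<..v} x :: real)" for x
      using le by (auto simp: indicator_def)
    then show ?thesis
      unfolding boot_ecdf_def by (simp only: diff_divide_distrib[symmetric] sum_subtractf[symmetric])
  qed
  moreover have "\<bar>F v - F u\<bar> = F v - F u"
    unfolding diff[of 0, symmetric] by simp
  ultimately show ?case
    using boot_frequency_deviation[OF X _ diff summ cbb n ln a] by simp
next
  case (sym u v)
  have "\<bar>boot_ecdf X l J n \<omega> u - boot_ecdf X l J n \<omega> v - (F u - F v)\<bar>
    = \<bar>boot_ecdf X l J n \<omega> v - boot_ecdf X l J n \<omega> u - (F v - F u)\<bar>" for \<omega>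
    by linarith
  then show ?case
    using sym by (simp add: abs_minus_commute)
qed

lemma (in prob_space) boot_ecdf_deviation:
  fixes X :: "int \<Rightarrow> 'a \<Rightarrow> real"
  assumes X: "\<And>i. X i \<in> borel_measurable M" and F: "\<And>i. F = cdf (distr M borel (X i))"
    and summ: "summable (\<lambda>n. mixing_coeff M X (Suc n))"
    and cbb: "cbb_start_indices M X l J" and n: "1 \<le> n" and ln: "l n \<in> {1..n}" and a: "0 < a"
  shows "prob {\<omega> \<in> space M. a \<le> sqrt (real n) * \<bar>boot_ecdf X l J n \<omega> t - F t\<bar>}
    \<le> 3 * cov_sum_bound M X (F t) / a\<^sup>2"
proof -
  have "prob (X i -` {..t} \<inter> space M) = F t" for i
    using X F[of i] by (simp add: cdf_def measure_distr)
  from boot_frequency_deviation[OF X _ this summ cbb n ln a] show ?thesis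
    unfolding boot_ecdf_def by simp
qed

subsection \<open>Ghosh's lemma\<close>

text \<open>Ghosh's lemma: if \<open>|W| \<le> K\<close> and \<open>|V - W| > 2\<epsilon>\<close>, then \<open>V\<close> and \<open>W\<close> are separated with a gap
  \<open>\<epsilon>\<close> by a point of the finite grid \<open>\<epsilon>\<int> \<inter> [-K - 2\<epsilon>, K + 2\<epsilon>]\<close>.\<close>

lemma (in prob_space) diff_tendsto_in_probability:
  fixes V W :: "nat \<Rightarrow> 'a \<Rightarrow> real"
  assumes [measurable]: "\<And>n. V n \<in> borel_measurable M" "\<And>n. W n \<in> borel_measurable M"
    and tight: "\<And>\<eta>. 0 < \<eta> \<Longrightarrow> \<exists>K. \<forall>\<^sub>F n in sequentially. prob {\<omega> \<in> space M. K < \<bar>W n \<omega>\<bar>} \<le> \<eta>"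
    and below: "\<And>v \<epsilon>. 0 < \<epsilon> \<Longrightarrow> (\<lambda>n. prob {\<omega> \<in> space M. V n \<omega> \<le> v \<and> v + \<epsilon> \<le> W n \<omega>}) \<longlonglongrightarrow> 0"
    and above: "\<And>v \<epsilon>. 0 < \<epsilon> \<Longrightarrow> (\<lambda>n. prob {\<omega> \<in> space M. v < V n \<omega> \<and> W n \<omega> \<le> v - \<epsilon>}) \<longlonglongrightarrow> 0"
    and e: "0 < e"
  shows "(\<lambda>n. prob {\<omega> \<in> space M. e < \<bar>V n \<omega> - W n \<omega>\<bar>}) \<longlonglongrightarrow> 0"
proof -
  define \<epsilon> where "\<epsilon> = e / 2"
  have \<epsilon>: "0 < \<epsilon>" "e = 2 * \<epsilon>"
    using e unfolding \<epsilon>_def by auto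
  let ?D = "\<lambda>n. {\<omega> \<in> space M. e < \<bar>V n \<omega> - W n \<omega>\<bar>}"
  let ?T = "\<lambda>n K. {\<omega> \<in> space M. K < \<bar>W n \<omega>\<bar>}"
  let ?L = "\<lambda>n i. {\<omega> \<in> space M. V n \<omega> \<le> \<epsilon> * real_of_int i \<and> \<epsilon> * real_of_int i + \<epsilon> \<le> W n \<omega>}"
  let ?U = "\<lambda>n i. {\<omega> \<in> space M. \<epsilon> * real_of_int i < V n \<omega> \<and> W n \<omega> \<le> \<epsilon> * real_of_int i - \<epsilon>}"
  have "\<forall>\<^sub>F n in sequentially. prob (?D n) < \<eta>" if \<eta>: "0 < \<eta>" for \<eta>
  proof -
    obtain K where K: "\<forall>\<^sub>F n in sequentially. prob (?T n K) \<le> \<eta> / 2"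
      using tight[of "\<eta> / 2"] \<eta> by auto
    \<comment> \<open>The grid index \<open>i\<close> chosen below is within 2 of
      \<open>w / \<epsilon>\<close>, which itself is at most \<open>K / \<epsilon>\<close> in
      absolute value.\<close>
    define N where "N = \<lceil>K / \<epsilon>\<rceil> + 2"
    let ?S = "\<lambda>n. (\<Sum>i\<in>{-N..N}. prob (?L n i)) + (\<Sum>i\<in>{-N..N}. prob (?U n i))"
    have bound: "prob (?D n) \<le> prob (?T n K) + ?S n" for n
    proof -
      have "?D n \<subseteq> ?T n K \<union> ((\<Union>i\<in>{-N..N}. ?L n i) \<union> (\<Union>i\<in>{-N..N}. ?U n i))"
      proof
        fix \<omega> assume \<omega>: "\<omega> \<in> ?D n"
        define w where "w = W n \<omega>"
        define v where "v = V n \<omega>"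
        have far: "2 * \<epsilon> < \<bar>v - w\<bar>" and sp: "\<omega> \<in> space M"
          using \<omega> \<epsilon> unfolding v_def w_def by auto
        show "\<omega> \<in> ?T n K \<union> ((\<Union>i\<in>{-N..N}. ?L n i) \<union> (\<Union>i\<in>{-N..N}. ?U n i))"
        proof (cases "K < \<bar>w\<bar>")
          case True
          then show ?thesis
            using sp unfolding w_def by simp
        next
          case False
          then have "\<bar>w / \<epsilon>\<bar> \<le> K / \<epsilon>"
            using \<epsilon> by (simp add: abs_divide divide_right_mono)
          then have wK: "w / \<epsilon> \<le> real_of_int \<lceil>K / \<epsilon>\<rceil>" "- real_of_int \<lceil>K / \<epsilon>\<rceil> \<le> w / \<epsilon>"
            using le_of_int_ceiling[of "K / \<epsilon>"] by linarith+
          show ?thesis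
          proof (cases "v < w")
            case True
            \<comment> \<open>This puts the grid point at least one step but less than two steps
              below \<open>w\<close>, hence above \<open>v\<close>, which is more than two steps
              away. The other case is its mirror image.\<close>
            define i where "i = \<lfloor>w / \<epsilon>\<rfloor> - 1"
            have i: "real_of_int i + 1 \<le> w / \<epsilon>" "w / \<epsilon> < real_of_int i + 2"
              unfolding i_def by linarith+
            have "\<epsilon> * real_of_int i + \<epsilon> \<le> w" "w < \<epsilon> * real_of_int i + 2 * \<epsilon>"
              using i \<epsilon> by (simp_all add: field_simps)
            moreover have "i \<in> {-N..N}"
              using i wK unfolding N_def by (auto intro!: of_int_le_iff[where 'a = real, THEN iffD1])
            ultimately show ?thesis
              using far True sp unfolding v_def w_def by fastforce
          next
            case False
            define i where "i = \<lceil>w / \<epsilon>\<rceil> + 1"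
            have i: "w / \<epsilon> \<le> real_of_int i - 1" "real_of_int i - 2 < w / \<epsilon>"
              unfolding i_def by linarith+
            have "w \<le> \<epsilon> * real_of_int i - \<epsilon>" "\<epsilon> * real_of_int i - 2 * \<epsilon> < w"
              using i \<epsilon> by (simp_all add: field_simps)
            moreover have "i \<in> {-N..N}"
              using i wK unfolding N_def by (auto intro!: of_int_le_iff[where 'a = real, THEN iffD1])
            ultimately show ?thesis
              using far False sp unfolding v_def w_def by fastforce
          qed
        qed
      qed
      then have "prob (?D n) \<le> prob (?T n K \<union> ((\<Union>i\<in>{-N..N}. ?L n i) \<union> (\<Union>i\<in>{-N..N}. ?U n i)))"
        by (rule finite_measure_mono) measurable
      also have "\<dots> \<le> prob (?T n K) + prob ((\<Union>i\<in>{-N..N}. ?L n i) \<union> (\<Union>i\<in>{-N..N}. ?U n i))"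
        by (rule measure_Un_le) measurable
      also have "prob ((\<Union>i\<in>{-N..N}. ?L n i) \<union> (\<Union>i\<in>{-N..N}. ?U n i))
        \<le> prob (\<Union>i\<in>{-N..N}. ?L n i) + prob (\<Union>i\<in>{-N..N}. ?U n i)"
        by (rule measure_Un_le) measurable
      also have "prob (\<Union>i\<in>{-N..N}. ?L n i) \<le> (\<Sum>i\<in>{-N..N}. prob (?L n i))"
        by (rule finite_measure_subadditive_finite) auto
      also have "prob (\<Union>i\<in>{-N..N}. ?U n i) \<le> (\<Sum>i\<in>{-N..N}. prob (?U n i))"
        by (rule finite_measure_subadditive_finite) auto
      finally show ?thesis
        by simp
    qed
    have "?S \<longlonglongrightarrow> 0"
      by (intro tendsto_add_zero tendsto_null_sum below above \<epsilon>)
    then have "\<forall>\<^sub>F n in sequentially. ?S n < \<eta> / 2"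
      using \<eta> by (intro order_tendstoD) auto
    with K show ?thesis
    proof eventually_elim
      case (elim n)
      then show ?case
        using bound[of n] by linarith
    qed
  qed
  then show ?thesis
    by (intro order_tendstoI) (auto intro: always_eventually less_le_trans[OF _ measure_nonneg])
qed

subsection \<open>Signed powers\<close>

text \<open>With \<open>c = M\<close> and \<open>a = \<rho>\<close> this is the limit function
  \<gamma> of the overview.\<close>

definition signed_power :: "real \<Rightarrow> real \<Rightarrow> real \<Rightarrow> real" where
  "signed_power c a x = c * \<bar>x\<bar> powr a * sgn x"

lemma signed_power_less:
  assumes "0 < c" "0 < a" "x < y"
  shows "signed_power c a x < signed_power c a y"
proof -
  consider "0 \<le> x" | "y \<le> 0" | "x < 0" "0 < y"
    by linarith
  then show ?thesis
  proof cases
    case 1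
    then show ?thesis
      using assms powr_less_mono2[of a x y] by (cases "x = 0") (auto simp: signed_power_def)
  next
    case 2
    then show ?thesis
      using assms powr_less_mono2[of a "- y" "- x"] by (cases "y = 0") (auto simp: signed_power_def)
  next
    case 3
    then have "signed_power c a x < 0" "0 < signed_power c a y"
      using assms by (auto simp: signed_power_def)
    then show ?thesis
      by simp
  qed
qed

text \<open>Identifies the form of the leading term of the representation as a preimage under
  \<gamma>.\<close>

lemma signed_power_inverse:
  assumes "0 < c" "0 < a"
  shows "signed_power c a ((\<bar>x\<bar> / c) powr (1 / a) * sgn x) = x"
proof (cases "x = 0")
  case False
  then have "\<bar>(\<bar>x\<bar> / c) powr (1 / a) * sgn x\<bar> = (\<bar>x\<bar> / c) powr (1 / a)"
    and "sgn ((\<bar>x\<bar> / c) powr (1 / a) * sgn x) = sgn x"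
    using assms by (auto simp: abs_mult sgn_mult)
  then show ?thesis
    using assms False by (simp add: signed_power_def powr_powr mult_sgn_abs mult.commute[of _ "sgn x"])
qed (simp add: signed_power_def)

text \<open>The inverse is homogeneous of degree 1/\<rho>, so the normalisation n^(1/(2\<rho>))
  outside becomes the root of n inside.\<close>

lemma signed_power_inverse_scale:
  assumes "0 \<le> r" "0 < c"
  shows "r powr (1 / (2 * \<rho>)) * ((\<bar>x\<bar> / c) powr (1 / \<rho>) * sgn x)
    = (\<bar>sqrt r * x\<bar> / c) powr (1 / \<rho>) * sgn (sqrt r * x)"
proof (cases "r = 0")
  case False
  then have "(\<bar>sqrt r * x\<bar> / c) powr (1 / \<rho>) = (sqrt r * (\<bar>x\<bar> / c)) powr (1 / \<rho>)"
    using assms by (simp add: abs_mult)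
  also have "\<dots> = sqrt r powr (1 / \<rho>) * (\<bar>x\<bar> / c) powr (1 / \<rho>)"
    using assms by (subst powr_mult[symmetric]) auto
  also have "sqrt r powr (1 / \<rho>) = r powr (1 / (2 * \<rho>))"
    using assms by (simp add: powr_half_sqrt[symmetric] powr_powr)
  finally show ?thesis
    using assms False by (simp add: sgn_mult)
qed simp

text \<open>Both the main term and the remainder are |h|^\<rho> times a bounded factor near 0, so
  the expansion contains continuity at \<open>t\<close>.\<close>

lemma signed_power_expansion_at_0:
  fixes F :: "real \<Rightarrow> real"
  assumes \<rho>: "0 < \<rho>"
    and exp: "(\<lambda>h. F (t + h) - F t - c * \<bar>h\<bar> powr \<rho> * sgn h) \<in> o[at 0](\<lambda>h. \<bar>h\<bar> powr \<rho>)"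
  shows "((\<lambda>h. F (t + h)) \<longlongrightarrow> F t) (at 0)"
proof -
  define r where "r h = (F (t + h) - F t - c * \<bar>h\<bar> powr \<rho> * sgn h) / \<bar>h\<bar> powr \<rho>" for h
  have r: "(r \<longlongrightarrow> 0) (at 0)"
    unfolding r_def by (rule smalloD_tendsto[OF exp])
  have pow: "((\<lambda>h. \<bar>h\<bar> powr \<rho>) \<longlongrightarrow> 0) (at 0)"
    using \<rho> by (intro tendsto_zero_powrI[of _ _ _ \<rho>]) (auto intro!: tendsto_eq_intros)
  have "((\<lambda>h. \<bar>h\<bar> powr \<rho> * (c * sgn h)) \<longlongrightarrow> 0) (at 0)"
    by (rule Lim_null_comparison[OF _ tendsto_mult_left_zero[OF pow, of "\<bar>c\<bar>"]])
      (auto intro!: always_eventually simp: abs_mult sgn_if mult_left_mono)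
  moreover have "((\<lambda>h. r h * \<bar>h\<bar> powr \<rho>) \<longlongrightarrow> 0 * 0) (at 0)"
    by (intro tendsto_mult r pow)
  ultimately have "((\<lambda>h. F t + (r h * \<bar>h\<bar> powr \<rho> + \<bar>h\<bar> powr \<rho> * (c * sgn h))) \<longlongrightarrow> F t + (0 * 0 + 0)) (at 0)"
    by (intro tendsto_add tendsto_const)
  moreover have "\<forall>\<^sub>F h in at 0. F t + (r h * \<bar>h\<bar> powr \<rho> + \<bar>h\<bar> powr \<rho> * (c * sgn h)) = F (t + h)"
    unfolding eventually_at by (intro exI[of _ 1]) (auto simp: r_def)
  ultimately show ?thesis
    by (auto elim: Lim_transform_eventually)
qed

text \<open>For h > 0 the quotient of F(t + h) - F(t) by h^\<rho> is nonnegative, and it tends to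
  \<open>c\<close>.\<close>

lemma signed_power_expansion_coeff_nonneg:
  fixes F :: "real \<Rightarrow> real"
  assumes mono: "mono F"
    and exp: "(\<lambda>h. F (t + h) - F t - c * \<bar>h\<bar> powr \<rho> * sgn h) \<in> o[at 0](\<lambda>h. \<bar>h\<bar> powr \<rho>)"
  shows "0 \<le> c"
proof -
  have lim: "((\<lambda>h. (F (t + h) - F t - c * \<bar>h\<bar> powr \<rho> * sgn h) / \<bar>h\<bar> powr \<rho> + c) \<longlongrightarrow> 0 + c) (at_right 0)"
    by (intro tendsto_add tendsto_const tendsto_within_subset[OF smalloD_tendsto[OF exp]]) simp
  have ev: "\<forall>\<^sub>F h in at_right 0. 0 \<le> (F (t + h) - F t - c * \<bar>h\<bar> powr \<rho> * sgn h) / \<bar>h\<bar> powr \<rho> + c"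
    unfolding eventually_at_right_field
    using monoD[OF mono, of t] by (intro exI[of _ 1]) (auto simp: diff_divide_distrib[of _ "c * _"])
  show ?thesis
    using tendsto_lowerbound[OF lim ev] by simp
qed

text \<open>At this \<open>h\<close> the power |h|^\<rho> equals |v|^\<rho> divided by the root of
  n, so the scaled remainder is |v|^\<rho> times a null sequence. The case \<open>v = 0\<close> is
  separate, since the expansion concerns a punctured neighbourhood.\<close>

lemma signed_power_expansion_rescaled:
  fixes F :: "real \<Rightarrow> real"
  assumes \<rho>: "0 < \<rho>"
    and exp: "(\<lambda>h. F (t + h) - F t - c * \<bar>h\<bar> powr \<rho> * sgn h) \<in> o[at 0](\<lambda>h. \<bar>h\<bar> powr \<rho>)"
  shows "(\<lambda>n. sqrt (real n) * (F (t + v * real n powr (- (1 / (2 * \<rho>)))) - F t))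
    \<longlonglongrightarrow> signed_power c \<rho> v"
proof (cases "v = 0")
  case False
  define r where "r h = (F (t + h) - F t - c * \<bar>h\<bar> powr \<rho> * sgn h) / \<bar>h\<bar> powr \<rho>" for h
  define h where "h n = v * real n powr (- (1 / (2 * \<rho>)))" for n
  have "(\<lambda>n. real n powr (- (1 / (2 * \<rho>)))) \<longlonglongrightarrow> 0"
    using \<rho> by (intro tendsto_neg_powr filterlim_real_sequentially) auto
  then have "h \<longlonglongrightarrow> 0"
    unfolding h_def by (rule tendsto_mult_right_zero)
  moreover have "\<forall>\<^sub>F n in sequentially. h n \<noteq> 0"
    using eventually_gt_at_top[of 0] by eventually_elim (simp add: h_def False)
  ultimately have "filterlim h (at 0) sequentially"
    by (simp add: filterlim_at)
  then have rh: "(\<lambda>n. r (h n)) \<longlonglongrightarrow> 0"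
    by (rule filterlim_compose[of r, rotated]) (unfold r_def, rule smalloD_tendsto[OF exp])
  have "(\<lambda>n. \<bar>v\<bar> powr \<rho> * r (h n) + signed_power c \<rho> v) \<longlonglongrightarrow> \<bar>v\<bar> powr \<rho> * 0 + signed_power c \<rho> v"
    by (intro tendsto_intros rh)
  moreover have "\<forall>\<^sub>F n in sequentially. \<bar>v\<bar> powr \<rho> * r (h n) + signed_power c \<rho> v = sqrt (real n) * (F (t + h n) - F t)"
    using eventually_gt_at_top[of 0]
  proof eventually_elim
    case (elim n)
    have "\<bar>h n\<bar> powr \<rho> = \<bar>v\<bar> powr \<rho> * real n powr (- (1 / 2))"
      using \<rho> by (simp add: h_def abs_mult powr_mult powr_powr)
    then have pow: "\<bar>v\<bar> powr \<rho> = sqrt (real n) * \<bar>h n\<bar> powr \<rho>"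
      using elim by (simp add: powr_minus powr_half_sqrt field_simps)
    have "h n \<noteq> 0" "sgn (h n) = sgn v"
      using elim False by (auto simp: h_def sgn_mult)
    then show ?case
      unfolding signed_power_def pow r_def by (simp add: field_simps)
  qed
  ultimately show ?thesis
    unfolding h_def by (auto elim: Lim_transform_eventually)
qed (simp add: signed_power_def)

subsection \<open>The Bahadur representation\<close>

text \<open>The scaled increment of \<open>F\<close> is eventually within \<delta>/2 of its limit,
  so a deviation by \<delta> forces a bootstrap fluctuation of at least \<delta>/2. The bound for
  the latter vanishes with the probability of the shrinking interval.\<close>

lemma (in prob_space) boot_local_increment_tendsto:
  fixes X :: "int \<Rightarrow> 'a \<Rightarrow> real" and \<rho> :: real
  assumes X: "\<And>i. X i \<in> borel_measurable M" and F: "\<And>i. F = cdf (distr M borel (X i))"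
    and summ: "summable (\<lambda>n. mixing_coeff M X (Suc n))"
    and cbb: "cbb_start_indices M X l J" and ln: "\<And>n. 1 \<le> n \<Longrightarrow> l n \<in> {1..n}"
    and h: "(\<lambda>n. F (t + h n)) \<longlonglongrightarrow> F t" "(\<lambda>n. sqrt (real n) * (F (t + h n) - F t)) \<longlonglongrightarrow> \<gamma>"
    and \<delta>: "0 < \<delta>"
  shows "(\<lambda>n. prob {\<omega> \<in> space M. \<delta> \<le>
    \<bar>sqrt (real n) * (boot_ecdf X l J n \<omega> (t + h n) - boot_ecdf X l J n \<omega> t) - \<gamma>\<bar>}) \<longlonglongrightarrow> 0"
proof -
  note [measurable] = boot_ecdf_measurable[OF X cbb]
  let ?C = "\<lambda>n. 3 * cov_sum_bound M X \<bar>F (t + h n) - F t\<bar> / (\<delta> / 2)\<^sup>2"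
  have "(\<lambda>n. \<bar>F (t + h n) - F t\<bar>) \<longlonglongrightarrow> 0"
    using tendsto_diff[OF h(1) tendsto_const[of "F t"]] by (intro tendsto_rabs_zero) simp
  then have "(\<lambda>n. cov_sum_bound M X \<bar>F (t + h n) - F t\<bar>) \<longlonglongrightarrow> 0"
    by (rule cov_sum_bound_tendsto_0[OF summ]) simp
  then have C: "?C \<longlonglongrightarrow> 0"
    using \<delta> by (auto intro!: tendsto_eq_intros)
  have "\<forall>\<^sub>F n in sequentially. \<bar>sqrt (real n) * (F (t + h n) - F t) - \<gamma>\<bar> < \<delta> / 2"
    using tendstoD[OF h(2), of "\<delta> / 2"] \<delta> by (simp add: dist_real_def)
  then have bound: "\<forall>\<^sub>F n in sequentially. prob {\<omega> \<in> space M. \<delta> \<le>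
    \<bar>sqrt (real n) * (boot_ecdf X l J n \<omega> (t + h n) - boot_ecdf X l J n \<omega> t) - \<gamma>\<bar>} \<le> ?C n"
    using eventually_ge_at_top[of 1]
  proof eventually_elim
    case (elim n)
    let ?G = "boot_ecdf X l J n"
    let ?d = "\<lambda>\<omega>. ?G \<omega> (t + h n) - ?G \<omega> t - (F (t + h n) - F t)"
    have "prob {\<omega> \<in> space M. \<delta> \<le> \<bar>sqrt (real n) * (?G \<omega> (t + h n) - ?G \<omega> t) - \<gamma>\<bar>}
      \<le> prob {\<omega> \<in> space M. \<delta> / 2 \<le> sqrt (real n) * \<bar>?d \<omega>\<bar>}"
    proof (rule finite_measure_mono)
      have "\<delta> / 2 \<le> sqrt (real n) * \<bar>?d \<omega>\<bar>"
        if "\<delta> \<le> \<bar>sqrt (real n) * (?G \<omega> (t + h n) - ?G \<omega> t) - \<gamma>\<bar>" for \<omega>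
      proof -
        have "sqrt (real n) * \<bar>?d \<omega>\<bar> = \<bar>sqrt (real n) * (?G \<omega> (t + h n) - ?G \<omega> t)
            - sqrt (real n) * (F (t + h n) - F t)\<bar>"
          by (simp add: abs_mult right_diff_distrib[symmetric])
        then show ?thesis
          using that elim(1) by linarith
      qed
      then show "{\<omega> \<in> space M. \<delta> \<le> \<bar>sqrt (real n) * (?G \<omega> (t + h n) - ?G \<omega> t) - \<gamma>\<bar>}
        \<subseteq> {\<omega> \<in> space M. \<delta> / 2 \<le> sqrt (real n) * \<bar>?d \<omega>\<bar>}"
        by blast
    qed measurable
    also have "\<dots> \<le> ?C n"
      using \<delta> by (intro boot_ecdf_increment_deviation[OF X F summ cbb elim(2) ln[OF elim(2)]]) simp
    finally show ?case .
  qed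
  show ?thesis
    by (rule tendsto_sandwich[OF _ bound tendsto_const C]) simp
qed

theorem theorem3:
  fixes P :: "'a measure" and X :: "int \<Rightarrow> 'a \<Rightarrow> real" and F :: "real \<Rightarrow> real"
    and p t\<^sub>p \<rho> M :: real and l :: "nat \<Rightarrow> nat" and J :: "nat \<Rightarrow> nat \<Rightarrow> 'a \<Rightarrow> nat"
  assumes "prob_space P"
    and "0 < p" and "p < 1"
    and "stationary_process P X"
    and "strongly_mixing P X"
    and "\<And>i. F = cdf (distr P borel (X i))"
    and "t\<^sub>p = quantile F p"
    and "\<rho> > 0" and "M \<noteq> 0"
    and "(\<lambda>h. F (t\<^sub>p + h) - F t\<^sub>p - M * \<bar>h\<bar> powr \<rho> * sgn h) \<in> o[at 0](\<lambda>h. \<bar>h\<bar> powr \<rho>)"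
    and "summable (\<lambda>n. mixing_coeff P X (Suc n))"
    and "\<And>n. n \<ge> 1 \<Longrightarrow> l n \<in> {1..n}"
    and "(\<lambda>n. 1 / real (l n) + real (l n) / real n) \<longlonglongrightarrow> 0"
    and "cbb_start_indices P X l J"
  shows "\<exists>R. (\<forall>n\<ge>1. \<forall>\<omega>\<in>space P.
            quantile (boot_ecdf X l J n \<omega>) p - t\<^sub>p
              = (\<bar>p - boot_ecdf X l J n \<omega> t\<^sub>p\<bar> / M) powr (1 / \<rho>)
                  * sgn (p - boot_ecdf X l J n \<omega> t\<^sub>p) + R n \<omega>)
          \<and> converges_in_probability P (\<lambda>n \<omega>. real n powr (1 / (2 * \<rho>)) * R n \<omega>) 0"
proof -
  interpret prob_space P by fact
  note p = assms(2,3) and F = assms(6) and \<rho> = assms(8) and expansion = assms(10)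
    and summ = assms(11) and ln = assms(12) and cbb = assms(14)
  have X: "X i \<in> borel_measurable P" for i
    using assms(4) unfolding stationary_process_def by blast
  interpret D: real_distribution "distr P borel (X 0)"
    using X by (rule real_distribution_distr)
  have monoF: "mono F"
    unfolding F[of 0] by (intro monoI D.cdf_nondecreasing)
  have M: "0 < M"
    using signed_power_expansion_coeff_nonneg[OF monoF expansion] assms(9) by simp
  have cont: "((\<lambda>h. F (t\<^sub>p + h)) \<longlongrightarrow> F t\<^sub>p) (at 0)"
    by (rule signed_power_expansion_at_0[OF \<rho> expansion])
  have Ftp: "F t\<^sub>p = p"
    unfolding assms(7)
  proof (rule cdf_at_quantile[OF monoF _ _ _ p])
    show "continuous (at_right t) F" for t
      unfolding F[of 0] by (rule D.cdf_is_right_cont)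
    show "(F \<longlongrightarrow> 0) at_bot" "(F \<longlongrightarrow> 1) at_top"
      unfolding F[of 0] by (rule D.cdf_lim_at_bot D.cdf_lim_at_top_prob)+
  qed (use cont assms(7) in simp)

  define G where "G n \<omega> = boot_ecdf X l J n \<omega>" for n \<omega>
  define D where "D n \<omega> = sqrt (real n) * (p - G n \<omega> t\<^sub>p)" for n \<omega>
  \<comment> \<open>\<open>V\<close> and \<open>W\<close> are the quantile error and the leading
    term, both multiplied by n^(1/(2\<rho>)); their difference will be the scaled remainder.\<close>
  define V where "V n \<omega> = real n powr (1 / (2 * \<rho>)) * (quantile (G n \<omega>) p - t\<^sub>p)" for n \<omega>
  define W where "W n \<omega> = (\<bar>D n \<omega>\<bar> / M) powr (1 / \<rho>) * sgn (D n \<omega>)" for n \<omega>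
  define \<gamma> where "\<gamma> = signed_power M \<rho>"
  define h where "h v n = v * real n powr (- (1 / (2 * \<rho>)))" for v n
  define Y where "Y v n \<omega> = sqrt (real n) * (G n \<omega> (t\<^sub>p + h v n) - G n \<omega> t\<^sub>p)" for v n \<omega>
  have G_meas [measurable]: "(\<lambda>\<omega>. G n \<omega> t) \<in> borel_measurable P" for n t
    unfolding G_def by (rule boot_ecdf_measurable[OF X cbb])
  have D_meas [measurable]: "D n \<in> borel_measurable P" for n
    unfolding D_def by measurable
  have W_meas [measurable]: "W n \<in> borel_measurable P" for n
    unfolding W_def by measurable
  have Y_meas [measurable]: "Y v n \<in> borel_measurable P" for v n
    unfolding Y_def by measurable
  have V_meas [measurable]: "V n \<in> borel_measurable P" for n
  \<comment> \<open>Convergence in probability demands measurability for every \<open>n\<close>; at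
    \<open>n = 0\<close> the factor \<open>0 powr _\<close> is 0 and makes \<open>V\<close>
    vanish.\<close>
  proof (cases "n = 0")
    case False
    then have n: "1 \<le> n"
      by simp
    have "(\<lambda>\<omega>. quantile (G n \<omega>) p) \<in> borel_measurable P"
      unfolding G_def by (rule boot_quantile_measurable[OF X cbb n ln[OF n] p])
    then show ?thesis
      unfolding V_def by measurable
  qed (simp add: V_def[abs_def])
  have \<gamma>W: "\<gamma> (W n \<omega>) = D n \<omega>" for n \<omega>
    unfolding \<gamma>_def W_def by (rule signed_power_inverse[OF M \<rho>])
  have \<gamma>_less: "x < y \<Longrightarrow> \<gamma> x < \<gamma> y" for x y
    unfolding \<gamma>_def by (rule signed_power_less[OF M \<rho>])
  have \<gamma>_le: "x \<le> y \<Longrightarrow> \<gamma> x \<le> \<gamma> y" for x y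
    using \<gamma>_less[of x y] by (cases "x = y") auto
  have V_le: "V n \<omega> \<le> v \<longleftrightarrow> D n \<omega> \<le> Y v n \<omega>" if n: "1 \<le> n" for n \<omega> v
  proof -
    have "V n \<omega> \<le> v \<longleftrightarrow> quantile (G n \<omega>) p \<le> t\<^sub>p + h v n"
      using n unfolding V_def h_def by (simp add: powr_minus field_simps)
    also have "\<dots> \<longleftrightarrow> p \<le> G n \<omega> (t\<^sub>p + h v n)"
      unfolding G_def by (rule boot_quantile_le_iff[of n l, OF n ln[OF n] p])
    also have "\<dots> \<longleftrightarrow> p - G n \<omega> t\<^sub>p \<le> G n \<omega> (t\<^sub>p + h v n) - G n \<omega> t\<^sub>p"
      by simp
    also have "\<dots> \<longleftrightarrow> D n \<omega> \<le> Y v n \<omega>"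
      unfolding D_def Y_def using n by simp
    finally show ?thesis .
  qed
  have Y_lim: "(\<lambda>n. prob {\<omega> \<in> space P. \<delta> \<le> \<bar>Y v n \<omega> - \<gamma> v\<bar>}) \<longlonglongrightarrow> 0" if "0 < \<delta>" for v \<delta>
  proof -
    have local: "(\<lambda>n. sqrt (real n) * (F (t\<^sub>p + h v n) - F t\<^sub>p)) \<longlonglongrightarrow> \<gamma> v"
      unfolding \<gamma>_def h_def by (rule signed_power_expansion_rescaled[OF \<rho> expansion])
    have "isCont F t\<^sub>p"
      using cont unfolding isCont_iff .
    moreover have "h v \<longlonglongrightarrow> 0"
      unfolding h_def using \<rho>
      by (intro tendsto_mult_right_zero tendsto_neg_powr filterlim_real_sequentially) auto
    then have "(\<lambda>n. t\<^sub>p + h v n) \<longlonglongrightarrow> t\<^sub>p"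
      using tendsto_add[OF tendsto_const] by fastforce
    ultimately have "(\<lambda>n. F (t\<^sub>p + h v n)) \<longlonglongrightarrow> F t\<^sub>p"
      by (rule isCont_tendsto_compose)
    from boot_local_increment_tendsto[OF X F summ cbb ln this local that] show ?thesis
      unfolding Y_def G_def .
  qed
  have tight: "\<exists>K. \<forall>\<^sub>F n in sequentially. prob {\<omega> \<in> space P. K < \<bar>W n \<omega>\<bar>} \<le> \<eta>" if \<eta>: "0 < \<eta>" for \<eta>
  proof -
    define C where "C = 3 * cov_sum_bound P X p"
    \<comment> \<open>Chosen so that the Chebyshev bound \<open>C / a^2\<close> is at most \<eta>;
      the summand 1 ensures positivity, as only \<open>0 \<le> C\<close> is at hand. Then
      \<open>K\<close> is the preimage of \<open>a\<close> under \<gamma>, so that |W| > K forces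
      |D| \<ge> a.\<close>
    define a where "a = sqrt (C / \<eta>) + 1"
    define K where "K = (a / M) powr (1 / \<rho>)"
    have C: "0 \<le> C"
      unfolding C_def using cov_sum_bound_nonneg[OF summ] p by simp
    have a: "0 < a"
      unfolding a_def using C \<eta> by (simp add: add_nonneg_pos)
    have "C / \<eta> = (sqrt (C / \<eta>))\<^sup>2"
      using C \<eta> by simp
    also have "\<dots> \<le> a\<^sup>2"
      unfolding a_def using C \<eta> by (intro power_mono) auto
    finally have Ca: "C / a\<^sup>2 \<le> \<eta>"
      using a \<eta> by (simp add: field_simps)
    have \<gamma>K: "\<gamma> K = a"
      using signed_power_inverse[OF M \<rho>, of a] a unfolding \<gamma>_def K_def by simp
    then have \<gamma>K': "\<gamma> (- K) = - a"
      unfolding \<gamma>_def signed_power_def by (simp add: sgn_minus)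
    have "prob {\<omega> \<in> space P. K < \<bar>W n \<omega>\<bar>} \<le> \<eta>" if n: "1 \<le> n" for n
    proof -
      have "prob {\<omega> \<in> space P. K < \<bar>W n \<omega>\<bar>}
        \<le> prob {\<omega> \<in> space P. a \<le> sqrt (real n) * \<bar>boot_ecdf X l J n \<omega> t\<^sub>p - F t\<^sub>p\<bar>}"
      proof (rule finite_measure_mono)
        have "a \<le> \<bar>D n \<omega>\<bar>" if "K < \<bar>W n \<omega>\<bar>" for \<omega>
          using that \<gamma>_less[of K "W n \<omega>"] \<gamma>_less[of "W n \<omega>" "- K"] \<gamma>W[of n \<omega>] \<gamma>K \<gamma>K'
          by linarith
        moreover have "\<bar>D n \<omega>\<bar> = sqrt (real n) * \<bar>boot_ecdf X l J n \<omega> t\<^sub>p - F t\<^sub>p\<bar>" for \<omega>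
          unfolding D_def G_def Ftp by (simp add: abs_mult abs_minus_commute)
        ultimately show "{\<omega> \<in> space P. K < \<bar>W n \<omega>\<bar>}
          \<subseteq> {\<omega> \<in> space P. a \<le> sqrt (real n) * \<bar>boot_ecdf X l J n \<omega> t\<^sub>p - F t\<^sub>p\<bar>}"
          by auto
        show "{\<omega> \<in> space P. a \<le> sqrt (real n) * \<bar>boot_ecdf X l J n \<omega> t\<^sub>p - F t\<^sub>p\<bar>} \<in> sets P"
          using G_meas unfolding G_def by measurable
      qed
      also have "\<dots> \<le> C / a\<^sup>2"
        using boot_ecdf_deviation[OF X F summ cbb n ln[OF n] a, of t\<^sub>p] unfolding C_def Ftp .
      finally show ?thesis
        using Ca by simp
    qed
    then show ?thesis
      unfolding eventually_sequentially by blast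
  qed
  \<comment> \<open>Common core of the two comparison conditions in Ghosh's lemma: an event that
    keeps \<open>Y v n\<close> a fixed distance away from its limit has vanishing
    probability.\<close>
  have separated: "(\<lambda>n. prob {\<omega> \<in> space P. A n \<omega>}) \<longlonglongrightarrow> 0"
    if \<delta>: "0 < \<delta>" and A: "\<And>n \<omega>. 1 \<le> n \<Longrightarrow> A n \<omega> \<Longrightarrow> \<delta> \<le> \<bar>Y v n \<omega> - \<gamma> v\<bar>" for A v \<delta>
  proof (rule tendsto_sandwich[OF _ _ tendsto_const Y_lim[OF \<delta>, of v]])
    show "\<forall>\<^sub>F n in sequentially. prob {\<omega> \<in> space P. A n \<omega>} \<le> prob {\<omega> \<in> space P. \<delta> \<le> \<bar>Y v n \<omega> - \<gamma> v\<bar>}"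
      using eventually_ge_at_top[of 1]
    proof eventually_elim
      case (elim n)
      have "{\<omega> \<in> space P. \<delta> \<le> \<bar>Y v n \<omega> - \<gamma> v\<bar>} \<in> sets P"
        by measurable
      then show ?case
        using A[OF elim] by (intro finite_measure_mono) auto
    qed
  qed simp
  have lim: "(\<lambda>n. prob {\<omega> \<in> space P. e < \<bar>V n \<omega> - W n \<omega>\<bar>}) \<longlonglongrightarrow> 0" if "0 < e" for e
  proof (rule diff_tendsto_in_probability[OF V_meas W_meas tight _ _ that])
    fix v \<epsilon> :: real assume \<epsilon>: "0 < \<epsilon>"
    show "(\<lambda>n. prob {\<omega> \<in> space P. V n \<omega> \<le> v \<and> v + \<epsilon> \<le> W n \<omega>}) \<longlonglongrightarrow> 0"
    \<comment> \<open>On this event Y \<ge> D = \<gamma>(W) \<ge> \<gamma>(v + \<epsilon>), while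
      the limit of Y is \<gamma>(v). In the second case Y < D = \<gamma>(W) \<le> \<gamma>(v -
      \<epsilon>).\<close>
    proof (rule separated[of "\<gamma> (v + \<epsilon>) - \<gamma> v"])
      show "0 < \<gamma> (v + \<epsilon>) - \<gamma> v"
        using \<gamma>_less \<epsilon> by simp
      show "\<gamma> (v + \<epsilon>) - \<gamma> v \<le> \<bar>Y v n \<omega> - \<gamma> v\<bar>"
        if "1 \<le> n" "V n \<omega> \<le> v \<and> v + \<epsilon> \<le> W n \<omega>" for n \<omega>
        using that V_le[of n \<omega> v] \<gamma>_le[of "v + \<epsilon>" "W n \<omega>"] \<gamma>W[of n \<omega>] by linarith
    qed
    show "(\<lambda>n. prob {\<omega> \<in> space P. v < V n \<omega> \<and> W n \<omega> \<le> v - \<epsilon>}) \<longlonglongrightarrow> 0"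
    proof (rule separated[of "\<gamma> v - \<gamma> (v - \<epsilon>)"])
      show "0 < \<gamma> v - \<gamma> (v - \<epsilon>)"
        using \<gamma>_less \<epsilon> by simp
      show "\<gamma> v - \<gamma> (v - \<epsilon>) \<le> \<bar>Y v n \<omega> - \<gamma> v\<bar>"
        if "1 \<le> n" "v < V n \<omega> \<and> W n \<omega> \<le> v - \<epsilon>" for n \<omega>
        using that V_le[of n \<omega> v] \<gamma>_le[of "W n \<omega>" "v - \<epsilon>"] \<gamma>W[of n \<omega>] by linarith
    qed
  qed
  \<comment> \<open>The remainder is defined by the representation itself, so the identity is
    immediate and the content is the rate just proved for
    \<open>V n \<omega> - W n \<omega>\<close>.\<close>
  define R where "R n \<omega> = quantile (G n \<omega>) p - t\<^sub>p
    - (\<bar>p - G n \<omega> t\<^sub>p\<bar> / M) powr (1 / \<rho>) * sgn (p - G n \<omega> t\<^sub>p)" for n \<omega>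
  have scaled: "real n powr (1 / (2 * \<rho>)) * R n \<omega> = V n \<omega> - W n \<omega>" for n \<omega>
    unfolding R_def V_def W_def D_def
    by (simp only: right_diff_distrib signed_power_inverse_scale[OF of_nat_0_le_iff M])
  have "converges_in_probability P (\<lambda>n \<omega>. real n powr (1 / (2 * \<rho>)) * R n \<omega>) 0"
    unfolding converges_in_probability_def scaled using lim by simp
  moreover have "\<forall>n\<ge>1. \<forall>\<omega>\<in>space P. quantile (boot_ecdf X l J n \<omega>) p - t\<^sub>p
    = (\<bar>p - boot_ecdf X l J n \<omega> t\<^sub>p\<bar> / M) powr (1 / \<rho>) * sgn (p - boot_ecdf X l J n \<omega> t\<^sub>p) + R n \<omega>"
    unfolding R_def G_def by simp
  ultimately show ?thesis
    by blast
qed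

end
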